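(* Let $C$ be a smooth plane sextic curve that admits an automorphism of maximal order $2$. Up to $K$-isomorphism, $C$ is defined by an equation of the form $$C: Z^6+Z^4L_{2,Z}+Z^2L_{4,Z}+L_{6,Z}=0$$ such that $L_{6,Z}$ is of degree $\geq5$ in both $X$ and $Y$, and at least one of the binary forms $L_{2,Z}$ and $L_{4,Z}$ is non-zero. Moreover, $\operatorname{Aut}(C)=\varrho_1(\mathbb{Z}/2\mathbb{Z})$ unless $L_{2,Z}$, $L_{4,Z}$ and $L_{6,Z}$ belong to the ring $K[X^2,Y^2]$. In the latter case, $\operatorname{Aut}(C)=\varrho_1((\mathbb{Z}/2\mathbb{Z})^2)$.
   Context: $K$ is an algebraically closed field of characteristic $p=0$ or $p>2g+1$, where $g=(d-1)(d-2)/2$ is the genus of a smooth plane curve of degree $d$; here $d=6$, so $g=10$. For a smooth plane curve $C:F(X,Y,Z)=0$ in $\mathbb{P}^2(K)$, $\operatorname{Aut}(C)$ is regarded as a subgroup of $\operatorname{PGL}_3(K)$, and two smooth plane models of a curve are $K$-isomorphic via a projective change of variables in $\operatorname{PGL}_3(K)$. "Admits an automorphism of maximal order $2$" means that $\operatorname{Aut}(C)$ contains an element of order $2$ and that every element of $\operatorname{Aut}(C)$ has order $\le 2$. $L_{i,Z}$ denotes a (generic) homogeneous polynomial of degree $i$ in the variables $X,Y$ over $K$. $\operatorname{diag}(1,a,b)$ denotes the projective transformation $X\mapsto X,\ Y\mapsto aY,\ Z\mapsto bZ$. The subgroups of $\operatorname{PGL}_3(K)$ are $\varrho_1(\mathbb{Z}/2\mathbb{Z}):=\langle\operatorname{diag}(1,1,-1)\rangle$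 and $\varrho_1((\mathbb{Z}/2\mathbb{Z})^2):=\langle\operatorname{diag}(1,1,-1),\operatorname{diag}(1,-1,1)\rangle$. *)

theory Defs
  imports
    "HOL-Analysis.Determinants"
    "HOL-Algebra.Multiplicative_Group"
    "HOL-Library.Poly_Mapping"
    "HOL-Computational_Algebra.Polynomial"
begin

section \<open>Polynomials in three variables\<close>

text \<open>
  The polynomial ring \<open>K[X,Y,Z]\<close>: finitely supported maps from monomials to coefficients, where
  a monomial is its exponent vector. The variables \<open>X\<close>, \<open>Y\<close>, \<open>Z\<close> have the indices
  \<open>1\<close>, \<open>2\<close>, \<open>3\<close> of the three-element type \<open>3\<close>, the index type of vectors in \<open>'a ^ 3\<close>.
\<close>

type_synonym 'a poly3 = "(3 \<Rightarrow>\<^sub>0 nat) \<Rightarrow>\<^sub>0 'a"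

definition Const :: "'a::comm_ring_1 \<Rightarrow> 'a poly3" where
  "Const c = Poly_Mapping.single 0 c"

definition Var :: "3 \<Rightarrow> 'a::comm_ring_1 poly3" where
  "Var i = Poly_Mapping.single (Poly_Mapping.single i 1) 1"

definition eval3 :: "'a::comm_ring_1 poly3 \<Rightarrow> 'a ^ 3 \<Rightarrow> 'a" where
  "eval3 P v = (\<Sum>m\<in>Poly_Mapping.keys P. Poly_Mapping.lookup P m *
                  (\<Prod>i\<in>UNIV. v $ i ^ Poly_Mapping.lookup m i))"

definition subst3 :: "(3 \<Rightarrow> 'a::comm_ring_1 poly3) \<Rightarrow> 'a poly3 \<Rightarrow> 'a poly3" where
  "subst3 \<sigma> P = (\<Sum>m\<in>Poly_Mapping.keys P. Const (Poly_Mapping.lookup P m) *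
                   (\<Prod>i\<in>UNIV. \<sigma> i ^ Poly_Mapping.lookup m i))"

text \<open>For exponent \<open>0\<close> the truncated subtraction is harmless, since the coefficient is then \<open>0\<close>.\<close>

definition partial_deriv :: "3 \<Rightarrow> 'a::comm_ring_1 poly3 \<Rightarrow> 'a poly3" where
  "partial_deriv i P = (\<Sum>m\<in>Poly_Mapping.keys P.
     Poly_Mapping.single (m - Poly_Mapping.single i 1)
       (of_nat (Poly_Mapping.lookup m i) * Poly_Mapping.lookup P m))"

definition homogeneous :: "nat \<Rightarrow> 'a::zero poly3 \<Rightarrow> bool" where
  "homogeneous d P \<longleftrightarrow> (\<forall>m\<in>Poly_Mapping.keys P. (\<Sum>i\<in>UNIV. Poly_Mapping.lookup m i) = d)"

definition degree_in :: "3 \<Rightarrow> 'a::zero poly3 \<Rightarrow> nat" where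
  "degree_in i P = Max (insert 0 ((\<lambda>m. Poly_Mapping.lookup m i) ` Poly_Mapping.keys P))"

definition polys_XY :: "'a::zero poly3 set" where
  "polys_XY = {P. \<forall>m\<in>Poly_Mapping.keys P. Poly_Mapping.lookup m 3 = 0}"

definition binary_form :: "nat \<Rightarrow> 'a::zero poly3 \<Rightarrow> bool" where
  "binary_form d P \<longleftrightarrow> P \<in> polys_XY \<and> homogeneous d P"

text \<open>The subring \<open>K[X\<^sup>2, Y\<^sup>2]\<close>.\<close>

definition polys_X2Y2 :: "'a::comm_ring_1 poly3 set" where
  "polys_X2Y2 = subst3 (\<lambda>i. Var i ^ 2) ` polys_XY"


section \<open>The projective linear group\<close>

definition GL3 :: "('a::field ^ 3 ^ 3) monoid" where
  "GL3 = \<lparr>carrier = {A. invertible A}, mult = (**), one = mat 1\<rparr>"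

definition scalars3 :: "('a::field ^ 3 ^ 3) set" where
  "scalars3 = {mat c | c. c \<noteq> 0}"

definition PGL3 :: "('a::field ^ 3 ^ 3) set monoid" where
  "PGL3 = GL3 Mod scalars3"

definition proj_class :: "'a::field ^ 3 ^ 3 \<Rightarrow> ('a ^ 3 ^ 3) set" where
  "proj_class A = scalars3 #>\<^bsub>GL3\<^esub> A"

lemma group_GL3: "group (GL3 :: ('a::field ^ 3 ^ 3) monoid)"
proof (rule groupI)
  fix A :: "'a ^ 3 ^ 3" assume "A \<in> carrier GL3"
  then obtain B where "A ** B = mat 1" "B ** A = mat 1"
    by (auto simp: GL3_def invertible_def)
  then show "\<exists>B\<in>carrier GL3. B \<otimes>\<^bsub>GL3\<^esub> A = \<one>\<^bsub>GL3\<^esub>"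
    by (intro bexI[of _ B]) (auto simp: GL3_def invertible_def)
qed (auto simp: GL3_def invertible_mult matrix_mul_assoc, auto simp: invertible_def intro: exI[of _ "mat 1"])

lemma mat_mult_left: "mat c ** A = (\<chi> i j. c * A $ i $ j)" for A :: "'a::field ^ 3 ^ 3"
  by (simp add: matrix_matrix_mult_def mat_def vec_eq_iff if_distrib[of "\<lambda>x. x * _"] cong: if_cong)

lemma mat_mult_right: "A ** mat c = (\<chi> i j. c * A $ i $ j)" for A :: "'a::field ^ 3 ^ 3"
  by (simp add: matrix_matrix_mult_def mat_def vec_eq_iff if_distrib[of "\<lambda>x. _ * x"] mult.commute cong: if_cong)

lemma mat_mult_mat: "mat c ** mat d = (mat (c * d) :: 'a::field ^ 3 ^ 3)"
  by (simp add: mat_mult_left) (simp add: mat_def vec_eq_iff)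

lemma normal_scalars3: "(scalars3 :: ('a::field ^ 3 ^ 3) set) \<lhd> GL3"
proof -
  interpret group "GL3 :: ('a ^ 3 ^ 3) monoid" by (rule group_GL3)
  have inv: "invertible (mat c :: 'a ^ 3 ^ 3)" if "c \<noteq> 0" for c
    using that unfolding invertible_def by (intro exI[of _ "mat (inverse c)"]) (simp add: mat_mult_mat)
  have inv_mat: "inv\<^bsub>GL3\<^esub> (mat c) = (mat (inverse c) :: 'a ^ 3 ^ 3)" if "c \<noteq> 0" for c
    by (rule inv_equality) (use that inv in \<open>auto simp: GL3_def mat_mult_mat\<close>)
  have "subgroup (scalars3 :: ('a ^ 3 ^ 3) set) GL3"
  proof (rule subgroupI)
    show "(scalars3 :: ('a ^ 3 ^ 3) set) \<subseteq> carrier GL3"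
      using inv by (auto simp: scalars3_def GL3_def)
    show "(scalars3 :: ('a ^ 3 ^ 3) set) \<noteq> {}"
      by (auto simp: scalars3_def intro: exI[of _ 1])
    show "inv\<^bsub>GL3\<^esub> A \<in> scalars3" if "A \<in> scalars3" for A :: "'a ^ 3 ^ 3"
      using that inv_mat by (auto simp: scalars3_def)
    show "A \<otimes>\<^bsub>GL3\<^esub> B \<in> scalars3" if "A \<in> scalars3" "B \<in> scalars3" for A B :: "'a ^ 3 ^ 3"
      using that by (fastforce simp: scalars3_def GL3_def mat_mult_mat)
  qed
  moreover have "scalars3 #>\<^bsub>GL3\<^esub> A = A <#\<^bsub>GL3\<^esub> scalars3" for A :: "'a ^ 3 ^ 3"
    by (auto simp: r_coset_def l_coset_def scalars3_def GL3_def mat_mult_left mat_mult_right)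
  ultimately show ?thesis
    by (intro normalI) auto
qed

lemma group_PGL3: "group (PGL3 :: ('a::field ^ 3 ^ 3) set monoid)"
  unfolding PGL3_def using normal_scalars3 by (rule normal.factorgroup_is_group)

text \<open>The class of the transformation \<open>X \<mapsto> X\<close>, \<open>Y \<mapsto> a Y\<close>, \<open>Z \<mapsto> b Z\<close>.\<close>

definition pdiag :: "'a::field \<Rightarrow> 'a \<Rightarrow> ('a ^ 3 ^ 3) set" where
  "pdiag a b = proj_class (\<chi> i j. if i = j then vector [1, a, b] $ i else 0)"

definition rho1_Z2 :: "('a::field ^ 3 ^ 3) set set" where
  "rho1_Z2 = generate PGL3 {pdiag 1 (- 1)}"

definition rho1_Z2_Z2 :: "('a::field ^ 3 ^ 3) set set" where
  "rho1_Z2_Z2 = generate PGL3 {pdiag 1 (- 1), pdiag (- 1) 1}"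


section \<open>Plane curves\<close>

text \<open>
  A plane curve is represented by a form \<open>F\<close> defining it; two forms define the same curve
  (as a subscheme of the projective plane) iff they differ by a nonzero constant factor.
  As the base field is algebraically closed, smoothness is the absence of
  singular \<open>K\<close>-points; it excludes \<open>F = 0\<close>.
\<close>

definition smooth_plane_curve :: "nat \<Rightarrow> 'a::alg_closed_field poly3 \<Rightarrow> bool" where
  "smooth_plane_curve d F \<longleftrightarrow> d > 0 \<and> homogeneous d F \<and>
     \<not> (\<exists>v. v \<noteq> 0 \<and> eval3 F v = 0 \<and> (\<forall>i. eval3 (partial_deriv i F) v = 0))"

definition plane_genus :: "nat \<Rightarrow> nat" where
  "plane_genus d = (d - 1) * (d - 2) div 2"

text \<open>\<open>F(A(X,Y,Z)\<^sup>T)\<close>\<close>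

definition lin_subst :: "'a::field ^ 3 ^ 3 \<Rightarrow> 'a poly3 \<Rightarrow> 'a poly3" where
  "lin_subst A F = subst3 (\<lambda>i. \<Sum>j\<in>UNIV. Const (A $ i $ j) * Var j) F"

definition proj_equiv :: "'a::field poly3 \<Rightarrow> 'a poly3 \<Rightarrow> bool" where
  "proj_equiv F G \<longleftrightarrow> (\<exists>A c. invertible A \<and> c \<noteq> 0 \<and> lin_subst A F = Const c * G)"

definition Aut_curve :: "'a::field poly3 \<Rightarrow> ('a ^ 3 ^ 3) set set" where
  "Aut_curve F = {proj_class A | A. invertible A \<and> (\<exists>c. c \<noteq> 0 \<and> lin_subst A F = Const c * F)}"

text \<open>\<open>group.ord\<close> is \<open>0\<close> for elements of infinite order, which therefore have to be excluded.\<close>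

definition max_automorphism_order :: "'a::field poly3 \<Rightarrow> nat \<Rightarrow> bool" where
  "max_automorphism_order F n \<longleftrightarrow>
     (\<exists>g\<in>Aut_curve F. group.ord PGL3 g = n) \<and>
     (\<forall>g\<in>Aut_curve F. 0 < group.ord PGL3 g \<and> group.ord PGL3 g \<le> n)"

end

theory Submission
  imports Defs
begin

text \<open>
  An involution of the projective plane in characteristic different from 2 is conjugate to
  \<open>diag(1,1,-1)\<close>, so after a change of variables the equation is even or odd in \<open>Z\<close>. The odd case
  is singular. In the even case smoothness at the three coordinate points forces the term \<open>Z\<^sup>6\<close> and
  the two degree bounds on \<open>L\<^sub>6\<close>, and \<open>L\<^sub>2 = L\<^sub>4 = 0\<close> would allow multiplying \<open>Z\<close> by a primitive
  cube root of unity, an automorphism of order 3. Since all automorphisms have order at most 2, they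
  commute, also as matrices with \<open>diag(1,1,-1)\<close> because its trace is nonzero. So a further
  automorphism acts on \<open>X, Y\<close> alone and is diagonalised there; then everything commutes with two
  diagonal involutions, hence is diagonal with entries \<open>\<plusminus>1\<close>.
\<close>

section \<open>Polynomials in three variables\<close>

abbreviation expo :: "(3 \<Rightarrow>\<^sub>0 nat) \<Rightarrow> 3 \<Rightarrow> nat" where
  "expo \<equiv> Poly_Mapping.lookup"

lemma prod_3: "prod f (UNIV :: 3 set) = f 1 * f 2 * f 3"
  unfolding UNIV_3 by (simp add: ac_simps)

lemma poly_mapping_eq_sum_single:
  "P = (\<Sum>m\<in>Poly_Mapping.keys P. Poly_Mapping.single m (Poly_Mapping.lookup P m))"
  by (rule poly_mapping_eqI)
    (auto simp: lookup_sum lookup_single when_def sum.delta' in_keys_iff)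

text \<open>Finite support makes every such map a finite sum of single terms. This suits claims
  additive in \<open>P\<close> before anything is known about products.\<close>

lemma poly_mapping_single_add_induct [case_names zero single add]:
  assumes "Q 0" "\<And>m c. Q (Poly_Mapping.single m c)" "\<And>p q. Q p \<Longrightarrow> Q q \<Longrightarrow> Q (p + q)"
  shows "Q (P :: 'b \<Rightarrow>\<^sub>0 'c::comm_monoid_add)"
proof -
  have "Q (\<Sum>m\<in>S. Poly_Mapping.single m (f m))" if "finite S" for S :: "'b set" and f
    using that by induction (auto intro: assms)
  from this[OF finite_keys[of P]] show ?thesis
    using poly_mapping_eq_sum_single[of P] by metis
qed

section \<open>Constants, variables and monomials\<close>

lemma Const_add: "Const (a + b) = Const a + Const b"
  and Const_mult: "Const (a * b) = Const a * Const b"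
  and Const_0 [simp]: "Const 0 = 0"
  and Const_1 [simp]: "Const 1 = 1"
  by (simp_all add: Const_def single_add mult_single flip: single_one)

lemma Const_power: "Const (a ^ n) = Const a ^ n"
  by (induction n) (simp_all add: Const_mult)

lemma Const_sum: "Const (sum f S) = (\<Sum>x\<in>S. Const (f x))"
  by (induction S rule: infinite_finite_induct) (simp_all add: Const_add)

lemma Const_prod: "Const (prod f S) = (\<Prod>x\<in>S. Const (f x))"
  by (induction S rule: infinite_finite_induct) (simp_all add: Const_mult)

lemma Const_eq_iff [simp]: "Const a = Const b \<longleftrightarrow> a = b"
  unfolding Const_def by (metis lookup_single_eq)

lemma lookup_Const_mult: "Poly_Mapping.lookup (Const c * P) m = c * Poly_Mapping.lookup P m"
proof (induction P rule: poly_mapping_single_add_induct)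
  case (single n d)
  show ?case by (simp add: Const_def mult_single lookup_single when_def)
qed (simp_all add: distrib_left lookup_add)

lemma keys_Const_mult:
  "c \<noteq> 0 \<Longrightarrow> Poly_Mapping.keys (Const c * P) = Poly_Mapping.keys (P :: 'a::field poly3)"
  by (auto simp: in_keys_iff lookup_Const_mult)

lemma Var_power: "Var i ^ n = Poly_Mapping.single (Poly_Mapping.single i n) 1"
  by (induction n) (simp_all add: Var_def mult_single flip: single_add)

lemma single_3_exponents:
  "Poly_Mapping.single (1::3) (expo m 1) + Poly_Mapping.single 2 (expo m 2)
    + Poly_Mapping.single 3 (expo m 3) = m"
proof (rule poly_mapping_eqI)
  fix i :: 3
  show "expo (Poly_Mapping.single (1::3) (expo m 1) + Poly_Mapping.single 2 (expo m 2)
    + Poly_Mapping.single 3 (expo m 3)) i = expo m i"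
    using exhaust_3[of i] by (auto simp: lookup_add lookup_single)
qed

lemma single_eq_Const_mult_Var:
  "Poly_Mapping.single m c = Const c * (Var 1 ^ expo m 1 * Var 2 ^ expo m 2 * Var 3 ^ expo m 3)"
  by (simp add: Var_power mult_single Const_def single_3_exponents)

text \<open>Constants and variables generate the ring, so identities between ring homomorphisms need
  checking on these generators only.\<close>

lemma poly3_induct [case_names Const Var add mult]:
  assumes "\<And>c. Q (Const c)" "\<And>i. Q (Var i)" "\<And>p q. Q p \<Longrightarrow> Q q \<Longrightarrow> Q (p + q)"
    "\<And>p q. Q p \<Longrightarrow> Q q \<Longrightarrow> Q (p * q)"
  shows "Q P"
proof (induction P rule: poly_mapping_single_add_induct)
  case zero
  show ?case using assms(1)[of 0] by simp
next
  case (single m c)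
  have "Q (Var i ^ n)" for i n
  proof (induction n)
    case 0
    show ?case using assms(1)[of 1] by simp
  qed (simp add: assms)
  then show ?case by (simp add: single_eq_Const_mult_Var assms)
qed (rule assms)

section \<open>Substitution and evaluation as ring homomorphisms\<close>

lemma subst3_0 [simp]: "subst3 \<sigma> 0 = 0"
  by (simp add: subst3_def)

lemma subst3_add: "subst3 \<sigma> (P + Q) = subst3 \<sigma> P + subst3 \<sigma> Q"
  unfolding subst3_def
  \<comment> \<open>Terms may cancel in \<open>P + Q\<close>, so the three key sets differ; as the
    summand is additive in the coefficient and vanishes at 0, all sums can run over a common
    set.\<close>
  by (rule setsum_keys_plus_distrib) (simp_all add: Const_add distrib_right)

lemma subst3_single:
  "subst3 \<sigma> (Poly_Mapping.single m c) = Const c * (\<Prod>i\<in>UNIV. \<sigma> i ^ expo m i)"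
  by (cases "c = 0") (simp_all add: subst3_def)

lemma subst3_Const [simp]: "subst3 \<sigma> (Const c) = Const c"
  by (simp add: Const_def[of c] subst3_single)

lemma subst3_1 [simp]: "subst3 \<sigma> 1 = 1"
  using subst3_Const[of \<sigma> 1] by simp

lemma subst3_Var [simp]: "subst3 \<sigma> (Var i) = \<sigma> i"
proof -
  have "\<sigma> j ^ expo (Poly_Mapping.single i 1) j = (if j = i then \<sigma> i else 1)" for j
    by (simp add: lookup_single when_def)
  then show ?thesis by (simp add: Var_def subst3_single)
qed

lemma subst3_mult: "subst3 \<sigma> (P * Q) = subst3 \<sigma> P * subst3 \<sigma> Q"
proof (induction P rule: poly_mapping_single_add_induct)
  case (single m c)
  show ?case
  proof (induction Q rule: poly_mapping_single_add_induct)
    case (single n d)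
    show ?case
      by (simp add: mult_single subst3_single lookup_add power_add prod.distrib Const_mult mult_ac)
  qed (simp_all add: subst3_add distrib_left)
qed (simp_all add: subst3_add distrib_right)

lemma subst3_sum: "subst3 \<sigma> (sum f S) = (\<Sum>x\<in>S. subst3 \<sigma> (f x))"
  by (induction S rule: infinite_finite_induct) (simp_all add: subst3_add)

lemma subst3_subst3: "subst3 \<sigma> (subst3 \<tau> P) = subst3 (\<lambda>i. subst3 \<sigma> (\<tau> i)) P"
  by (induction P rule: poly3_induct) (simp_all add: subst3_add subst3_mult)

lemma subst3_Var_id [simp]: "subst3 Var P = P"
  by (induction P rule: poly3_induct) (simp_all add: subst3_add subst3_mult)

text \<open>Evaluation is substitution of constants. Since \<open>Const\<close> is injective, the
  laws for \<open>eval3\<close> are inherited from those for \<open>subst3\<close>.\<close>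

lemma Const_eval3: "Const (eval3 P v) = subst3 (\<lambda>i. Const (v $ i)) P"
  by (simp add: eval3_def subst3_def Const_sum Const_mult Const_prod Const_power)

lemma eval3_Const [simp]: "eval3 (Const c) v = c"
  and eval3_Var [simp]: "eval3 (Var i) v = v $ i"
  and eval3_add: "eval3 (P + Q) v = eval3 P v + eval3 Q v"
  and eval3_mult: "eval3 (P * Q) v = eval3 P v * eval3 Q v"
  by (simp_all add: Const_eval3 subst3_add subst3_mult Const_add Const_mult flip: Const_eq_iff)

lemma eval3_sum: "eval3 (sum f S) v = (\<Sum>x\<in>S. eval3 (f x) v)"
  by (simp add: Const_eval3 subst3_sum Const_sum flip: Const_eq_iff)

lemma eval3_single: "eval3 (Poly_Mapping.single m c) v = c * (\<Prod>i\<in>UNIV. v $ i ^ expo m i)"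
  by (cases "c = 0") (simp_all add: eval3_def)

lemma eval3_subst3: "eval3 (subst3 \<sigma> P) v = eval3 P (\<chi> i. eval3 (\<sigma> i) v)"
  by (induction P rule: poly3_induct) (simp_all add: subst3_add subst3_mult eval3_add eval3_mult)

section \<open>Formal partial derivatives\<close>

lemma partial_deriv_0 [simp]: "partial_deriv i 0 = 0"
  by (simp add: partial_deriv_def)

lemma partial_deriv_add: "partial_deriv i (P + Q) = partial_deriv i P + partial_deriv i Q"
  unfolding partial_deriv_def
  by (rule setsum_keys_plus_distrib) (simp_all add: distrib_left single_add)

lemma partial_deriv_single:
  "partial_deriv i (Poly_Mapping.single m c) =
    Poly_Mapping.single (m - Poly_Mapping.single i 1) (of_nat (expo m i) * c)"
  by (cases "c = 0") (simp_all add: partial_deriv_def)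

text \<open>Both sides are biadditive, which reduces the Leibniz rule to a product of two
  terms.\<close>

lemma partial_deriv_mult:
  "partial_deriv i (P * Q) = partial_deriv i P * Q + P * partial_deriv i Q"
proof (induction P rule: poly_mapping_single_add_induct)
  case (single m c)
  show ?case
  proof (induction Q rule: poly_mapping_single_add_induct)
    case (single n d)
    let ?e = "Poly_Mapping.single i (1::nat)"
    \<comment> \<open>Truncated subtraction commutes with adding \<open>n\<close> only if the
      variable occurs in \<open>m\<close>; otherwise the factor \<open>of_nat 0\<close> kills both
      terms.\<close>
    have minus: "m + n - ?e = m - ?e + n" if "expo m i > 0" for m n :: "3 \<Rightarrow>\<^sub>0 nat"
      using that by (intro poly_mapping_eqI) (auto simp: lookup_add lookup_minus lookup_single when_def)
    have 1: "Poly_Mapping.single (m + n - ?e) (of_nat (expo m i) * (c * d)) =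
        Poly_Mapping.single (m - ?e + n) (of_nat (expo m i) * (c * d))"
      using minus[of m n] by (cases "expo m i = 0") simp_all
    have 2: "Poly_Mapping.single (m + n - ?e) (of_nat (expo n i) * (c * d)) =
        Poly_Mapping.single (m + (n - ?e)) (of_nat (expo n i) * (c * d))"
      using minus[of n m] by (cases "expo n i = 0") (simp_all add: add.commute)
    have "partial_deriv i (Poly_Mapping.single m c * Poly_Mapping.single n d) =
        Poly_Mapping.single (m + n - ?e) (of_nat (expo m i) * (c * d)) +
        Poly_Mapping.single (m + n - ?e) (of_nat (expo n i) * (c * d))"
      by (simp add: partial_deriv_single mult_single lookup_add distrib_right flip: single_add)
    also have "\<dots> = partial_deriv i (Poly_Mapping.single m c) * Poly_Mapping.single n d
        + Poly_Mapping.single m c * partial_deriv i (Poly_Mapping.single n d)"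
      unfolding 1 2 by (simp only: partial_deriv_single mult_single mult.assoc mult.left_commute[of c])
    finally show ?case .
  qed (simp_all add: partial_deriv_add distrib_left)
qed (simp_all add: partial_deriv_add distrib_right)

lemma partial_deriv_Const [simp]: "partial_deriv i (Const c) = 0"
  by (simp add: Const_def partial_deriv_single)

lemma partial_deriv_Var: "partial_deriv i (Var j) = (if i = j then 1 else 0)"
  by (simp add: Var_def partial_deriv_single lookup_single)

lemma partial_deriv_sum: "partial_deriv i (sum f S) = (\<Sum>x\<in>S. partial_deriv i (f x))"
  by (induction S rule: infinite_finite_induct) (simp_all add: partial_deriv_add)

text \<open>The chain rule, reduced to the ring generators by additivity and the Leibniz
  rule.\<close>

lemma partial_deriv_subst3:
  "partial_deriv i (subst3 \<sigma> P) =
    (\<Sum>j\<in>UNIV. subst3 \<sigma> (partial_deriv j P) * partial_deriv i (\<sigma> j))"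
proof (induction P rule: poly3_induct)
  case (Var k)
  show ?case by (simp add: partial_deriv_Var if_distrib[of "subst3 \<sigma>"] if_distrib[of "\<lambda>x. x * _"] cong: if_cong)
next
  case (add p q)
  then show ?case by (simp add: subst3_add partial_deriv_add distrib_right sum.distrib)
next
  case (mult p q)
  then show ?case
    by (simp add: subst3_mult subst3_add partial_deriv_mult sum.distrib sum_distrib_left
        sum_distrib_right algebra_simps)
qed simp

section \<open>Homogeneous polynomials\<close>

lemma homogeneous_Const: "homogeneous 0 (Const c)"
  by (simp add: homogeneous_def Const_def)

lemma homogeneous_1: "homogeneous 0 (1 :: 'a::comm_ring_1 poly3)"
  using homogeneous_Const[of "1 :: 'a"] by simp

lemma homogeneous_Var: "homogeneous 1 (Var i)"
  using exhaust_3[of i] by (auto simp: homogeneous_def Var_def lookup_single sum_3)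

lemma homogeneous_sum: "(\<And>x. x \<in> S \<Longrightarrow> homogeneous d (f x)) \<Longrightarrow> homogeneous d (sum f S)"
  unfolding homogeneous_def using keys_sum[of f S] by blast

lemma homogeneous_mult:
  assumes "homogeneous d P" "homogeneous e Q"
  shows "homogeneous (d + e) (P * Q)"
  using assms keys_mult[of P Q] by (fastforce simp: homogeneous_def lookup_add sum.distrib)

lemma homogeneous_power:
  "homogeneous d P \<Longrightarrow> homogeneous (n * d) (P ^ n)" for P :: "'a::comm_ring_1 poly3"
proof (induction n)
  case 0
  show ?case using homogeneous_1 by simp
qed (simp add: homogeneous_mult)

lemma homogeneous_subst3:
  assumes "\<And>i. homogeneous 1 (\<sigma> i)" "homogeneous d P"
  shows "homogeneous d (subst3 \<sigma> P)"
  unfolding subst3_def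
proof (rule homogeneous_sum)
  fix m assume "m \<in> Poly_Mapping.keys P"
  then have d: "expo m 1 + expo m 2 + expo m 3 = d"
    using assms(2) by (simp add: homogeneous_def sum_3)
  have "homogeneous (expo m i) (\<sigma> i ^ expo m i)" for i
    using homogeneous_power[OF assms(1), of "expo m i"] by simp
  then have "homogeneous (0 + (expo m 1 + expo m 2 + expo m 3))
      (Const (Poly_Mapping.lookup P m) * (\<sigma> 1 ^ expo m 1 * \<sigma> 2 ^ expo m 2 * \<sigma> 3 ^ expo m 3))"
    by (intro homogeneous_mult homogeneous_Const)
  then show "homogeneous d (Const (Poly_Mapping.lookup P m) * (\<Prod>i\<in>UNIV. \<sigma> i ^ expo m i))"
    by (simp add: d prod_3)
qed

section \<open>Linear changes of variables\<close>

lemma lin_subst_mult_Const: "lin_subst A (Const c * P) = Const c * lin_subst A P"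
  by (simp add: lin_subst_def subst3_mult)

lemma lin_subst_mat_1 [simp]: "lin_subst (mat 1) P = P"
proof -
  have "(\<Sum>j\<in>UNIV. Const ((mat 1 :: 'a ^ 3 ^ 3) $ i $ j) * Var j) = Var i" for i
    using exhaust_3[of i] by (auto simp: sum_3 mat_def)
  then show ?thesis by (simp add: lin_subst_def)
qed

text \<open>Replacing \<open>v\<close> by \<open>A v\<close> in \<open>P(B v)\<close> gives
  \<open>P(B A v)\<close>: matrices act from the right, hence the reversed order.\<close>

lemma lin_subst_lin_subst: "lin_subst A (lin_subst B P) = lin_subst (B ** A) P"
proof -
  have "(\<Sum>j\<in>UNIV. Const (B $ i $ j) * (\<Sum>k\<in>UNIV. Const (A $ j $ k) * Var k)) =
      (\<Sum>k\<in>UNIV. Const ((B ** A) $ i $ k) * Var k)" for i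
    by (simp add: matrix_matrix_mult_def sum_3 Const_add Const_mult algebra_simps)
  then show ?thesis
    by (simp add: lin_subst_def subst3_subst3 subst3_sum subst3_mult)
qed

lemma homogeneous_lin_subst: "homogeneous d P \<Longrightarrow> homogeneous d (lin_subst A P)"
  unfolding lin_subst_def
proof (rule homogeneous_subst3)
  show "homogeneous 1 (\<Sum>j\<in>UNIV. Const (A $ i $ j) * Var j)" for i
    using homogeneous_mult[OF homogeneous_Const homogeneous_Var] by (intro homogeneous_sum) simp
qed

lemma eval3_lin_subst: "eval3 (lin_subst A P) v = eval3 P (A *v v)"
proof -
  have "(\<chi> i. eval3 (\<Sum>j\<in>UNIV. Const (A $ i $ j) * Var j) v) = A *v v"
    by (simp add: vec_eq_iff eval3_sum eval3_mult matrix_vector_mult_def)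
  then show ?thesis by (simp add: lin_subst_def eval3_subst3)
qed

lemma eval3_partial_deriv_lin_subst:
  "eval3 (partial_deriv i (lin_subst A P)) v =
    (\<Sum>j\<in>UNIV. eval3 (partial_deriv j P) (A *v v) * A $ j $ i)"
proof -
  have "partial_deriv i (\<Sum>k\<in>UNIV. Const (A $ j $ k) * Var k) = Const (A $ j $ i)" for j
    by (simp add: partial_deriv_sum partial_deriv_mult partial_deriv_Var if_distrib cong: if_cong)
  then show ?thesis
    by (simp add: lin_subst_def partial_deriv_subst3 eval3_sum[where S = UNIV] eval3_mult
        eval3_lin_subst[unfolded lin_subst_def])
qed

text \<open>A singular point \<open>v\<close> of the transformed curve would give the singular point
  \<open>A v\<close> of the original one.\<close>

lemma smooth_lin_subst:
  assumes "smooth_plane_curve d F" "invertible A"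
  shows "smooth_plane_curve d (lin_subst A F)"
  unfolding smooth_plane_curve_def
proof (intro conjI notI)
  show "d > 0" "homogeneous d (lin_subst A F)"
    using assms by (auto simp: smooth_plane_curve_def homogeneous_lin_subst)
  assume "\<exists>v. v \<noteq> 0 \<and> eval3 (lin_subst A F) v = 0 \<and>
    (\<forall>i. eval3 (partial_deriv i (lin_subst A F)) v = 0)"
  then obtain v where v: "v \<noteq> 0" "eval3 F (A *v v) = 0"
    and grad: "\<And>i. (\<Sum>j\<in>UNIV. eval3 (partial_deriv j F) (A *v v) * A $ j $ i) = 0"
    by (auto simp: eval3_lin_subst eval3_partial_deriv_lin_subst)
  obtain B where B: "A ** B = mat 1" "B ** A = mat 1"
    using assms(2) by (auto simp: invertible_def)
  \<comment> \<open>The gradient of \<open>F\<close> at \<open>A v\<close> as a row vector. The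
    chain rule gives \<open>g A = 0\<close>, and \<open>A\<close> can be cancelled.\<close>
  define g where "g = (\<chi> j. eval3 (partial_deriv j F) (A *v v))"
  have "g v* A = 0"
    using grad by (simp add: vec_eq_iff vector_matrix_mult_def g_def mult.commute)
  then have "g v* (A ** B) = 0"
    by (simp flip: vector_matrix_mul_assoc)
  then have "g = 0"
    using B by simp
  then have "eval3 (partial_deriv j F) (A *v v) = 0" for j
    by (simp add: g_def vec_eq_iff)
  moreover have "A *v v \<noteq> 0"
  proof
    assume "A *v v = 0"
    then have "(B ** A) *v v = 0" by (simp flip: matrix_vector_mul_assoc)
    then show False using v B by simp
  qed
  ultimately show False
    using v assms(1) by (auto simp: smooth_plane_curve_def)
qed

section \<open>Matrices and the projective linear group\<close>

lemma mat_commute: "mat c ** A = A ** mat c" for A :: "'a::field ^ 3 ^ 3"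
  by (simp add: mat_mult_left mat_mult_right)

lemma mat_mult_cancel: "mat c ** A = mat c ** B \<Longrightarrow> c \<noteq> 0 \<Longrightarrow> A = B" for A :: "'a::field ^ 3 ^ 3"
  by (simp add: mat_mult_left vec_eq_iff)

lemma mat_mult_vec: "mat c *v x = c *s x" for x :: "'a::field ^ 3"
  by (simp add: matrix_vector_mult_def mat_def vec_eq_iff if_distrib[of "\<lambda>x. x * _"] cong: if_cong)

lemma invertible_mat_iff: "invertible (mat c :: 'a::field ^ 3 ^ 3) \<longleftrightarrow> c \<noteq> 0"
proof
  assume "c \<noteq> 0"
  then have "mat c ** mat (inverse c) = (mat 1 :: 'a ^ 3 ^ 3)"
    by (simp add: mat_mult_mat)
  then show "invertible (mat c :: 'a ^ 3 ^ 3)"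
    using invertible_right_inverse by blast
qed (auto simp: invertible_det_nz det_3 mat_def)

lemma trace_mat_mult: "trace (mat c ** A) = c * trace A" for A :: "'a::field ^ 3 ^ 3"
  by (simp add: trace_def mat_mult_left sum_distrib_left)

definition diag3 :: "'a \<Rightarrow> 'a \<Rightarrow> 'a \<Rightarrow> 'a::field ^ 3 ^ 3" where
  "diag3 a b c = (\<chi> i j. if i = j then vector [a, b, c] $ i else 0)"

lemma diag3_mult: "diag3 a b c ** diag3 a' b' c' = diag3 (a * a') (b * b') (c * c')"
  by (simp add: diag3_def matrix_matrix_mult_def vec_eq_iff forall_3 sum_3)

lemma diag3_eq_mat: "diag3 a a a = mat a"
  by (simp add: diag3_def mat_def vec_eq_iff forall_3)

lemma diag3_eq_iff: "diag3 a b c = diag3 a' b' c' \<longleftrightarrow> a = a' \<and> b = b' \<and> c = c'"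
  by (auto simp: diag3_def vec_eq_iff forall_3)

lemma mat_mult_diag3: "mat k ** diag3 a b c = diag3 (k * a) (k * b) (k * c)"
  by (simp flip: diag3_eq_mat add: diag3_mult)

lemma invertible_diag3: "a \<noteq> 0 \<Longrightarrow> b \<noteq> 0 \<Longrightarrow> c \<noteq> 0 \<Longrightarrow> invertible (diag3 a b c)"
  by (simp add: invertible_det_nz det_3 diag3_def)

lemma trace_diag3: "trace (diag3 a b c) = a + b + c"
  by (simp add: trace_def diag3_def sum_3)

text \<open>The commutation relation entry by entry: an entry of \<open>A\<close> must vanish
  wherever the two diagonal values involved differ.\<close>

lemma commute_diag3:
  assumes "A ** diag3 a b c = diag3 a b c ** A"
  shows "A $ i $ j * vector [a, b, c] $ j = vector [a, b, c] $ i * A $ i $ j"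
proof -
  have "(A ** diag3 a b c) $ i $ j = (diag3 a b c ** A) $ i $ j"
    using assms by simp
  then show ?thesis
    by (simp add: diag3_def matrix_matrix_mult_def if_distrib[of "\<lambda>x. x * _"]
        if_distrib[of "\<lambda>x. _ * x"] cong: if_cong)
qed

section \<open>Classes in the projective linear group and the two subgroups\<close>

lemma proj_class_altdef: "proj_class A = {mat c ** A | c. c \<noteq> 0}"
  by (auto simp: proj_class_def r_coset_def scalars3_def GL3_def)

lemma proj_class_eq_iff:
  "proj_class A = proj_class B \<longleftrightarrow> (\<exists>c. c \<noteq> 0 \<and> A = mat c ** B)"
proof
  assume "proj_class A = proj_class B"
  moreover have "A \<in> proj_class A"
    unfolding proj_class_altdef by (auto intro!: exI[of _ 1])
  ultimately show "\<exists>c. c \<noteq> 0 \<and> A = mat c ** B"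
    by (auto simp: proj_class_altdef)
next
  assume "\<exists>c. c \<noteq> 0 \<and> A = mat c ** B"
  then obtain c where c: "c \<noteq> 0" "A = mat c ** B" by blast
  have "mat d ** B = mat (d / c) ** A" "mat d ** A = mat (d * c) ** B" for d
    using c by (simp_all add: matrix_mul_assoc mat_mult_mat)
  with c(1) show "proj_class A = proj_class B"
    unfolding proj_class_altdef by (safe; metis divide_eq_0_iff mult_eq_0_iff)
qed

lemma proj_class_mult:
  assumes "invertible A" "invertible B"
  shows "proj_class A \<otimes>\<^bsub>PGL3\<^esub> proj_class B = proj_class (A ** B)"
  using normal.rcos_sum[OF normal_scalars3, of A B] assms
  by (simp add: proj_class_def PGL3_def FactGroup_def GL3_def)

lemma one_PGL3: "\<one>\<^bsub>PGL3\<^esub> = proj_class (mat 1)"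
  by (auto simp: PGL3_def FactGroup_def proj_class_altdef scalars3_def)

lemma proj_class_in_PGL3: "invertible A \<Longrightarrow> proj_class A \<in> carrier PGL3"
  by (auto simp: PGL3_def FactGroup_def RCOSETS_def proj_class_def GL3_def)

text \<open>Elements of square one are their own inverses, so closure under products suffices. This
  bounds the generated groups from above.\<close>

lemma subgroup_proj_class_involutions:
  assumes one: "mat 1 \<in> M" and mult: "\<And>A B. A \<in> M \<Longrightarrow> B \<in> M \<Longrightarrow> A ** B \<in> M"
    and square: "\<And>A. A \<in> M \<Longrightarrow> A ** A = mat 1"
  shows "subgroup (proj_class ` M) PGL3"
proof -
  interpret group "PGL3 :: ('a ^ 3 ^ 3) set monoid" by (rule group_PGL3)
  have inv: "invertible A" if "A \<in> M" for A
    using square[OF that] by (auto simp: invertible_def)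
  show ?thesis
  proof (rule subgroupI)
    show "inv\<^bsub>PGL3\<^esub> g \<in> proj_class ` M" if g: "g \<in> proj_class ` M" for g
    proof -
      from g obtain A where A: "A \<in> M" "g = proj_class A" by blast
      then have "inv\<^bsub>PGL3\<^esub> g = g"
        by (intro inv_equality) (simp_all add: inv proj_class_mult square one_PGL3 proj_class_in_PGL3)
      then show ?thesis using g by simp
    qed
  qed (use one mult inv in \<open>auto simp: proj_class_mult proj_class_in_PGL3\<close>)
qed

lemma pdiag_eq: "pdiag a b = proj_class (diag3 1 a b)"
  by (simp add: pdiag_def diag3_def)

lemma rho1_Z2_eq: "rho1_Z2 = (proj_class :: 'a::field ^ 3 ^ 3 \<Rightarrow> _) ` {mat 1, diag3 1 1 (- 1)}"
    (is "_ = proj_class ` ?M")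
proof (rule equalityI)
  interpret group "PGL3 :: ('a ^ 3 ^ 3) set monoid" by (rule group_PGL3)
  show "rho1_Z2 \<subseteq> proj_class ` ?M"
    unfolding rho1_Z2_def
  proof (rule generate_subgroup_incl)
    show "subgroup (proj_class ` ?M) PGL3"
      by (rule subgroup_proj_class_involutions) (auto simp: diag3_mult simp flip: diag3_eq_mat)
  qed (auto simp: pdiag_eq)
  show "proj_class ` ?M \<subseteq> rho1_Z2"
    unfolding rho1_Z2_def
    using generate.one[of PGL3] by (auto simp: pdiag_eq one_PGL3 intro: generate.incl)
qed

lemma rho1_Z2_Z2_eq:
  "rho1_Z2_Z2 = (proj_class :: 'a::field ^ 3 ^ 3 \<Rightarrow> _) ` {mat 1, diag3 1 1 (- 1), diag3 1 (- 1) 1, diag3 1 (- 1) (- 1)}"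
    (is "_ = proj_class ` ?M")
proof (rule equalityI)
  interpret group "PGL3 :: ('a ^ 3 ^ 3) set monoid" by (rule group_PGL3)
  show "rho1_Z2_Z2 \<subseteq> proj_class ` ?M"
    unfolding rho1_Z2_Z2_def
  proof (rule generate_subgroup_incl)
    show "subgroup (proj_class ` ?M) PGL3"
      by (rule subgroup_proj_class_involutions) (auto simp: diag3_mult simp flip: diag3_eq_mat)
  qed (auto simp: pdiag_eq)
  \<comment> \<open>The product of the two generators supplies the fourth element, the class of
    \<open>diag3 1 (- 1) (- 1)\<close>.\<close>
  have "pdiag 1 (- 1) \<otimes>\<^bsub>PGL3\<^esub> pdiag (- 1) 1 \<in> generate PGL3 {pdiag 1 (- 1), pdiag (- 1) (1::'a)}"
    by (intro generate.eng generate.incl) auto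
  then show "proj_class ` ?M \<subseteq> rho1_Z2_Z2"
    unfolding rho1_Z2_Z2_def
    using generate.one[of PGL3]
    by (auto simp: pdiag_eq one_PGL3 proj_class_mult invertible_diag3 diag3_mult intro: generate.incl)
qed

section \<open>Normal forms of involutions\<close>

definition colmat :: "'a ^ 3 \<Rightarrow> 'a ^ 3 \<Rightarrow> 'a ^ 3 \<Rightarrow> 'a::field ^ 3 ^ 3" where
  "colmat u v w = (\<chi> i j. (vector [u, v, w] :: 'a ^ 3 ^ 3) $ j $ i)"

lemma mult_colmat: "A ** colmat u v w = colmat (A *v u) (A *v v) (A *v w)"
  by (simp add: colmat_def matrix_matrix_mult_def matrix_vector_mult_def vec_eq_iff forall_3)

lemma colmat_mult_diag3: "colmat u v w ** diag3 a b c = colmat (a *s u) (b *s v) (c *s w)"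
  by (simp add: colmat_def diag3_def matrix_matrix_mult_def vec_eq_iff forall_3 sum_3 mult.commute)

lemma det_colmat:
  "det (colmat u v w) = u $ 1 * (v $ 2 * w $ 3 - v $ 3 * w $ 2)
     + u $ 2 * (v $ 3 * w $ 1 - v $ 1 * w $ 3) + u $ 3 * (v $ 1 * w $ 2 - v $ 2 * w $ 1)"
  by (simp add: det_3 colmat_def algebra_simps)

text \<open>The eigenvalues \<open>a\<close> and \<open>- a\<close> are distinct because
  \<open>2 * a\<close> is nonzero, so \<open>u\<close> and \<open>w\<close> are independent and some
  unit vector completes them to a basis.\<close>

lemma eigenvectors_extend_to_basis:
  fixes A :: "'a::field ^ 3 ^ 3"
  assumes u: "A *v u = a *s u" "u \<noteq> 0" and w: "A *v w = (- a) *s w" "w \<noteq> 0"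
    and a: "a \<noteq> 0" "(2::'a) \<noteq> 0"
  shows "\<exists>k. det (colmat u w (axis k 1)) \<noteq> 0"
proof (rule ccontr)
  assume "\<not> ?thesis"
  then have "det (colmat u w (axis 1 1)) = 0" "det (colmat u w (axis 2 1)) = 0"
    "det (colmat u w (axis 3 1)) = 0"
    by auto
  \<comment> \<open>Up to sign, the three determinants are the 2x2 minors of the pair
    \<open>u\<close>, \<open>w\<close>; if they all vanish, \<open>u\<close> is a multiple of
    \<open>w\<close>.\<close>
  then have minors: "u $ i * w $ j = u $ j * w $ i" for i j
    using exhaust_3[of i] exhaust_3[of j] by (auto simp: det_colmat axis_def mult.commute)
  obtain j where j: "w $ j \<noteq> 0"
    using w(2) by (auto simp: vec_eq_iff)
  define t where "t = u $ j / w $ j"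
  have ut: "u = t *s w"
    using minors[of _ j] j by (simp add: vec_eq_iff t_def field_simps)
  have "a *s u = - (a *s u)"
    using u(1) w(1) unfolding ut by (simp add: matrix_vector_mult_scaleR vec.scale vec_eq_iff)
  then have "2 * a * u $ i = 0" for i
    by (auto simp: vec_eq_iff eq_neg_iff_add_eq_0 simp flip: mult_2)
  then show False
    using a u(2) by (metis mult_eq_0_iff vec_eq_iff zero_index)
qed

text \<open>Since \<open>(A - a)(A + a) = 0\<close>, the vectors \<open>A x + a x\<close> and
  \<open>A x - a x\<close> are eigenvectors for \<open>a\<close> and \<open>- a\<close> unless zero.
  Both eigenvalues occur, and in dimension 3 one of them is double.\<close>

lemma involution_normal_form:
  fixes A :: "'a::field ^ 3 ^ 3"
  assumes sq: "A ** A = mat (a * a)" and a: "a \<noteq> 0" "(2::'a) \<noteq> 0"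
    and nonscalar: "A \<noteq> mat a" "A \<noteq> mat (- a)"
  shows "\<exists>P k. invertible P \<and> k \<noteq> 0 \<and> A ** P = P ** (mat k ** diag3 1 1 (- 1))"
proof -
  have AA: "A *v (A *v x) = (a * a) *s x" for x
    by (simp add: matrix_vector_mul_assoc sq mat_mult_vec)
  have plus: "A *v (A *v x + a *s x) = a *s (A *v x + a *s x)" for x
    by (simp add: AA vec.add vec.scale vec_eq_iff algebra_simps)
  have minus: "A *v (A *v x - a *s x) = (- a) *s (A *v x - a *s x)" for x
    by (simp add: AA vec.diff vec.scale vec_eq_iff algebra_simps)
  obtain x where x: "A *v x - a *s x \<noteq> 0"
    using nonscalar(1) by (auto simp: matrix_eq mat_mult_vec)
  obtain y where y: "A *v y + a *s y \<noteq> 0"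
    using nonscalar(2) by (auto simp: matrix_eq mat_mult_vec eq_neg_iff_add_eq_0)
  define u w where "u = A *v y + a *s y" and "w = A *v x - a *s x"
  have u: "A *v u = a *s u" "u \<noteq> 0" and w: "A *v w = (- a) *s w" "w \<noteq> 0"
    using plus minus x y by (simp_all add: u_def w_def)
  obtain l where l: "det (colmat u w (axis l 1)) \<noteq> 0"
    using eigenvectors_extend_to_basis[OF u w a] by blast
  define e where "e = (axis l 1 :: 'a ^ 3)"
  define p q where "p = A *v e + a *s e" and "q = A *v e - a *s e"
  have p: "A *v p = a *s p" and q: "A *v q = (- a) *s q"
    using plus minus by (simp_all add: p_def q_def)
  \<comment> \<open>As \<open>p - q = 2 a e\<close>, linearity of the determinant in the last column
    shows that \<open>p\<close> or \<open>q\<close> can replace \<open>e\<close> in the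
    basis.\<close>
  have "2 * a * det (colmat u w e) = det (colmat u w p) - det (colmat u w q)"
    by (simp add: det_colmat p_def q_def algebra_simps)
  then consider "det (colmat u w p) \<noteq> 0" | "det (colmat u w q) \<noteq> 0"
    using l a by (force simp: e_def)
  then show ?thesis
  proof cases
    case 1
    have "det (colmat u p w) = - det (colmat u w p)"
      by (simp add: det_colmat algebra_simps)
    then have "invertible (colmat u p w)"
      using 1 by (simp add: invertible_det_nz)
    moreover have "A ** colmat u p w = colmat u p w ** (mat a ** diag3 1 1 (- 1))"
      by (simp add: mult_colmat mat_mult_diag3 colmat_mult_diag3 u w p)
    ultimately show ?thesis using a by blast
  next
    case 2
    \<comment> \<open>Here \<open>- a\<close> is the double eigenvalue. The column for the simple
      one goes last, so the scalar factor becomes \<open>- a\<close>.\<close>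
    have "det (colmat w q u) = det (colmat u w q)"
      by (simp add: det_colmat algebra_simps)
    then have "invertible (colmat w q u)"
      using 2 by (simp add: invertible_det_nz)
    moreover have "A ** colmat w q u = colmat w q u ** (mat (- a) ** diag3 1 1 (- 1))"
      by (simp add: mult_colmat mat_mult_diag3 colmat_mult_diag3 u w q)
    ultimately show ?thesis using a by (metis neg_equal_0_iff_equal)
  qed
qed

text \<open>Commuting with \<open>diag3 1 1 (- 1)\<close> makes \<open>A\<close> block diagonal, so
  it can be diagonalised on the plane where the third coordinate is 0. Such a base change commutes
  with \<open>diag3 1 1 (- 1)\<close> too.\<close>

lemma block_involution_normal_form:
  fixes A :: "'a::field ^ 3 ^ 3"
  assumes sq: "A ** A = mat c" and inv: "invertible A" and two: "(2::'a) \<noteq> 0"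
    and comm: "A ** diag3 1 1 (- 1) = diag3 1 1 (- 1) ** A"
    and new: "\<And>k. A \<noteq> mat k" "\<And>k. A \<noteq> mat k ** diag3 1 1 (- 1)"
  shows "\<exists>P k. invertible P \<and> k \<noteq> 0 \<and> A ** P = P ** (mat k ** diag3 1 (- 1) 1)
    \<and> diag3 1 1 (- 1) ** P = P ** diag3 1 1 (- 1)"
proof -
  have neq: "x \<noteq> - x" if "x \<noteq> 0" for x :: 'a
    using that two by (metis add.right_inverse mult_2 mult_eq_0_iff)
  have z: "A $ 1 $ 3 = 0" "A $ 2 $ 3 = 0" "A $ 3 $ 1 = 0" "A $ 3 $ 2 = 0"
    using commute_diag3[OF comm, of 1 3] commute_diag3[OF comm, of 2 3]
      commute_diag3[OF comm, of 3 1] commute_diag3[OF comm, of 3 2] neq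
    by auto
  \<comment> \<open>With this choice of square root of \<open>c\<close>, the third unit vector is an
    eigenvector for \<open>a\<close>.\<close>
  define a where "a = A $ 3 $ 3"
  have a: "a \<noteq> 0"
    using inv z by (auto simp: invertible_det_nz det_3 a_def)
  have "c = a * a"
    using arg_cong[OF sq, of "\<lambda>M. M $ 3 $ 3"] z
    by (simp add: matrix_matrix_mult_def sum_3 mat_def a_def)
  then have AA: "A *v (A *v x) = (a * a) *s x" for x
    by (simp add: matrix_vector_mul_assoc sq mat_mult_vec)
  have plus: "A *v (A *v x + a *s x) = a *s (A *v x + a *s x)" for x
    by (simp add: AA vec.add vec.scale vec_eq_iff algebra_simps)
  have minus: "A *v (A *v x - a *s x) = (- a) *s (A *v x - a *s x)" for x
    by (simp add: AA vec.diff vec.scale vec_eq_iff algebra_simps)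
  have A3: "(A *v x) $ 3 = a * x $ 3" for x
    by (simp add: matrix_vector_mult_def sum_3 z a_def)
  \<comment> \<open>Both eigenvalues occur on the plane: if only \<open>a\<close> did,
    \<open>A\<close> would be scalar; if only \<open>- a\<close> did, \<open>A\<close> would be a
    multiple of \<open>diag3 1 1 (- 1)\<close>.\<close>
  have "\<exists>x. x $ 3 = 0 \<and> A *v x - a *s x \<noteq> 0"
  proof (rule ccontr)
    assume *: "\<not> ?thesis"
    have "A = mat a"
      using *[simplified, rule_format, of "axis 1 1"] *[simplified, rule_format, of "axis 2 1"] z
      by (simp add: vec_eq_iff forall_3 matrix_vector_mult_def sum_3 axis_def mat_def a_def)
    then show False using new(1) by blast
  qed
  then obtain x where x: "x $ 3 = 0" "A *v x - a *s x \<noteq> 0" by blast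
  have "\<exists>y. y $ 3 = 0 \<and> A *v y + a *s y \<noteq> 0"
  proof (rule ccontr)
    assume *: "\<not> ?thesis"
    have "A = mat (- a) ** diag3 1 1 (- 1)"
      using *[simplified, rule_format, of "axis 1 1"] *[simplified, rule_format, of "axis 2 1"] z
      unfolding mat_mult_diag3
      by (simp add: vec_eq_iff forall_3 matrix_vector_mult_def sum_3 axis_def diag3_def a_def
          eq_neg_iff_add_eq_0)
    then show False using new(2) by blast
  qed
  then obtain y where y: "y $ 3 = 0" "A *v y + a *s y \<noteq> 0" by blast
  define u w where "u = A *v y + a *s y" and "w = A *v x - a *s x"
  have u: "A *v u = a *s u" "u \<noteq> 0" and w: "A *v w = (- a) *s w" "w \<noteq> 0"
    using plus minus x y by (simp_all add: u_def w_def)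
  have uw3: "u $ 3 = 0" "w $ 3 = 0"
    using x y by (simp_all add: u_def w_def A3)
  obtain l where "det (colmat u w (axis l 1)) \<noteq> 0"
    using eigenvectors_extend_to_basis[OF u w a two] by blast
  \<comment> \<open>Both \<open>u\<close> and \<open>w\<close> have third coordinate 0, so the
    completing unit vector must be the third one.\<close>
  then have "det (colmat u w (axis 3 1)) \<noteq> 0"
    using exhaust_3[of l] by (auto simp: det_colmat uw3 axis_def)
  then have "invertible (colmat u w (axis 3 1))"
    by (simp add: invertible_det_nz)
  moreover have "A *v axis 3 1 = a *s axis 3 1"
    by (simp add: vec_eq_iff forall_3 matrix_vector_mult_def sum_3 axis_def z a_def)
  then have "A ** colmat u w (axis 3 1) = colmat u w (axis 3 1) ** (mat a ** diag3 1 (- 1) 1)"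
    by (simp add: mult_colmat mat_mult_diag3 colmat_mult_diag3 u w)
  moreover have "diag3 1 1 (- 1) ** colmat u w (axis 3 1) = colmat u w (axis 3 1) ** diag3 1 1 (- 1)"
    unfolding colmat_mult_diag3 mult_colmat
    by (simp add: uw3 colmat_def vec_eq_iff forall_3 diag3_def matrix_vector_mult_def sum_3 axis_def)
  ultimately show ?thesis using a by blast
qed

section \<open>Automorphisms\<close>

text \<open>Stated for matrices rather than classes, because the arguments compare traces and
  entries of representatives.\<close>

definition is_automorphism :: "'a::field poly3 \<Rightarrow> 'a ^ 3 ^ 3 \<Rightarrow> bool" where
  "is_automorphism F A \<longleftrightarrow> invertible A \<and> (\<exists>c. c \<noteq> 0 \<and> lin_subst A F = Const c * F)"

lemma Aut_curve_eq: "Aut_curve F = proj_class ` {A. is_automorphism F A}"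
  by (auto simp: Aut_curve_def is_automorphism_def)

lemma Aut_curve_Const_mult:
  assumes "c \<noteq> 0"
  shows "Aut_curve (Const c * F) = Aut_curve F"
proof -
  have "Const c * P = Const c * Q \<longleftrightarrow> P = Q" for P Q :: "'a poly3"
  proof
    assume "Const c * P = Const c * Q"
    then have "Const (inverse c * c) * P = Const (inverse c * c) * Q"
      by (simp only: Const_mult mult.assoc)
    then show "P = Q" using assms by simp
  qed simp
  then show ?thesis
    by (simp add: Aut_curve_def lin_subst_mult_Const mult.left_commute[of _ "Const c"])
qed

lemma is_automorphism_mult:
  assumes "is_automorphism F A" "is_automorphism F B"
  shows "is_automorphism F (A ** B)"
proof -
  obtain a b where ab: "a \<noteq> 0" "lin_subst A F = Const a * F" "b \<noteq> 0" "lin_subst B F = Const b * F"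
    using assms by (auto simp: is_automorphism_def)
  then have "lin_subst (A ** B) F = Const (a * b) * F"
    by (simp add: lin_subst_lin_subst[symmetric] lin_subst_mult_Const Const_mult mult.assoc)
  moreover have "invertible (A ** B)"
    using assms by (simp add: is_automorphism_def invertible_mult)
  ultimately show ?thesis
    using ab unfolding is_automorphism_def by (intro conjI exI[of _ "a * b"]) simp_all
qed

text \<open>Here \<open>B\<close> is the conjugate of \<open>A\<close> by \<open>P\<close>; the
  equation \<open>A ** P = P ** B\<close> avoids naming the inverse.\<close>

lemma is_automorphism_lin_subst:
  assumes "is_automorphism F A" "invertible P" "A ** P = P ** B"
  shows "is_automorphism (lin_subst P F) B"
proof -
  obtain Q where Q: "P ** Q = mat 1" "Q ** P = mat 1"
    using assms(2) by (auto simp: invertible_def)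
  have "Q ** (A ** P) = B"
    by (simp add: assms(3) matrix_mul_assoc Q)
  moreover have "invertible (Q ** (A ** P))"
  proof (intro invertible_mult)
    show "invertible Q" "invertible P" "invertible A"
      using Q assms by (auto simp: invertible_def[of Q] is_automorphism_def)
  qed
  moreover obtain c where c: "c \<noteq> 0" "lin_subst A F = Const c * F"
    using assms by (auto simp: is_automorphism_def)
  then have "lin_subst B (lin_subst P F) = Const c * lin_subst P F"
    by (simp add: lin_subst_lin_subst assms(3)[symmetric])
      (simp add: lin_subst_lin_subst[symmetric] lin_subst_mult_Const)
  ultimately show ?thesis
    using c by (auto simp: is_automorphism_def)
qed

text \<open>The matrix version of saying that the automorphism group has exponent dividing
  2.\<close>

definition automorphisms_square_to_scalars :: "'a::field poly3 \<Rightarrow> bool" where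
  "automorphisms_square_to_scalars F \<longleftrightarrow> (\<forall>A. is_automorphism F A \<longrightarrow> (\<exists>c. A ** A = mat c))"

lemma automorphisms_square_to_scalars_lin_subst:
  assumes sq: "automorphisms_square_to_scalars F" and "invertible P"
  shows "automorphisms_square_to_scalars (lin_subst P F)"
  unfolding automorphisms_square_to_scalars_def
proof (intro allI impI)
  fix B assume B: "is_automorphism (lin_subst P F) B"
  obtain Q where Q: "P ** Q = mat 1" "Q ** P = mat 1"
    using assms(2) by (auto simp: invertible_def)
  then have "invertible Q"
    by (auto simp: invertible_def)
  moreover have "B ** Q = Q ** (P ** B ** Q)"
    by (simp add: matrix_mul_assoc Q)
  ultimately have "is_automorphism (lin_subst Q (lin_subst P F)) (P ** B ** Q)"
    by (rule is_automorphism_lin_subst[OF B])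
  then have "is_automorphism F (P ** B ** Q)"
    by (simp add: lin_subst_lin_subst Q)
  then obtain c where "(P ** B ** Q) ** (P ** B ** Q) = mat c"
    using sq by (auto simp: automorphisms_square_to_scalars_def)
  then have "Q ** ((P ** B ** Q) ** (P ** B ** Q)) ** P = mat c"
    by (simp add: mat_commute[symmetric] flip: matrix_mul_assoc) (simp add: matrix_mul_assoc Q)
  moreover have "Q ** ((P ** B ** Q) ** (P ** B ** Q)) ** P = (Q ** P) ** B ** (Q ** P) ** B ** (Q ** P)"
    by (simp only: matrix_mul_assoc)
  ultimately have "B ** B = mat c"
    by (simp add: Q)
  then show "\<exists>c. B ** B = mat c" ..
qed

text \<open>In a group of exponent two the representatives commute up to a scalar, and comparing traces
  shows that this scalar is one.\<close>

lemma automorphisms_commute: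
  assumes sq: "automorphisms_square_to_scalars F" and A: "is_automorphism F A"
    and B: "is_automorphism F B" and tr: "trace B \<noteq> 0"
  shows "A ** B = B ** A"
proof -
  obtain a b c where abc: "A ** A = mat a" "B ** B = mat b" "(A ** B) ** (A ** B) = mat c"
    using sq A B is_automorphism_mult[OF A B] unfolding automorphisms_square_to_scalars_def by metis
  have "invertible (mat a :: 'a ^ 3 ^ 3)" "invertible (mat b :: 'a ^ 3 ^ 3)"
    using A B by (auto simp: is_automorphism_def invertible_mult simp flip: abc)
  then have nz: "a \<noteq> 0" "b \<noteq> 0"
    by (simp_all add: invertible_mat_iff)
  \<comment> \<open>Evaluating \<open>A (AB)(AB) B\<close> in two ways, through the squares of
    \<open>A\<close> and \<open>B\<close> or through that of \<open>AB\<close>, relates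
    \<open>AB\<close> and \<open>BA\<close> by a scalar.\<close>
  have "A ** ((A ** B) ** (A ** B)) ** B = mat a ** (B ** A) ** mat b"
    by (simp add: matrix_mul_assoc flip: abc)
  moreover have "A ** mat c ** B = mat c ** (A ** B)"
    by (simp only: mat_commute[of c A, symmetric] matrix_mul_assoc)
  moreover have "mat a ** (B ** A) ** mat b = mat (a * b) ** (B ** A)"
    by (simp only: mat_commute[of b, symmetric] matrix_mul_assoc mat_mult_mat mult.commute[of a])
  ultimately have eq: "mat c ** (A ** B) = mat (a * b) ** (B ** A)"
    unfolding abc by simp
  then have "mat c ** (A ** B) ** A = mat (a * b) ** (B ** A) ** A"
    by simp
  then have *: "mat c ** (A ** B ** A) = mat (a * b) ** (B ** mat a)"
    by (simp add: abc(1) flip: matrix_mul_assoc)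
  \<comment> \<open>By cyclicity \<open>A B A\<close> has the trace of \<open>A A B\<close>, namely
    \<open>a * trace B\<close>, which is nonzero; so the two scalars agree.\<close>
  have "trace (A ** B ** A) = trace (mat a ** B)"
    by (metis abc(1) matrix_mul_assoc trace_mul_sym)
  then have "c * (a * trace B) = (a * b) * (a * trace B)"
    using arg_cong[OF *, of trace] by (simp add: trace_mat_mult flip: mat_commute)
  then have "c = a * b"
    using nz tr by simp
  then show ?thesis
    using eq nz mat_mult_cancel by (metis mult_eq_0_iff)
qed

section \<open>Diagonal automorphisms\<close>

lemma lookup_lin_subst_diag3:
  "Poly_Mapping.lookup (lin_subst (diag3 a b c) F) m =
    a ^ expo m 1 * b ^ expo m 2 * c ^ expo m 3 * Poly_Mapping.lookup F m"
proof (induction F rule: poly_mapping_single_add_induct)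
  case (single n d)
  have "(\<Sum>j\<in>UNIV. Const (diag3 a b c $ i $ j) * Var j) = Const (vector [a, b, c] $ i) * Var i" for i
    by (simp add: diag3_def if_distrib[of Const] if_distrib[of "\<lambda>x. x * _"] cong: if_cong)
  then have "lin_subst (diag3 a b c) (Poly_Mapping.single n d) =
      Const d * (\<Prod>i\<in>UNIV. (Const (vector [a, b, c] $ i) * Var i) ^ expo n i)"
    by (simp add: lin_subst_def subst3_single)
  also have "\<dots> = Const (a ^ expo n 1 * b ^ expo n 2 * c ^ expo n 3) * Poly_Mapping.single n d"
    by (simp add: prod_3 single_eq_Const_mult_Var Const_mult Const_power power_mult_distrib mult_ac)
  finally show ?case
    by (simp add: lookup_Const_mult lookup_single when_def)
qed (simp_all add: lin_subst_def subst3_add lookup_add distrib_left)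

text \<open>A diagonal substitution only rescales each monomial, so invariance up to a constant is a
  condition on exponents.\<close>

lemma is_automorphism_diag3_iff:
  assumes "a \<noteq> 0" "b \<noteq> 0" "c \<noteq> 0"
  shows "is_automorphism F (diag3 a b c) \<longleftrightarrow>
    (\<exists>k. k \<noteq> 0 \<and> (\<forall>m\<in>Poly_Mapping.keys F. a ^ expo m 1 * b ^ expo m 2 * c ^ expo m 3 = k))"
proof -
  have "lin_subst (diag3 a b c) F = Const k * F \<longleftrightarrow>
      (\<forall>m\<in>Poly_Mapping.keys F. a ^ expo m 1 * b ^ expo m 2 * c ^ expo m 3 = k)" for k
    by (auto simp: poly_mapping_eq_iff fun_eq_iff lookup_lin_subst_diag3 lookup_Const_mult in_keys_iff)
  then show ?thesis
    using assms by (simp add: is_automorphism_def invertible_diag3)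
qed

lemma is_automorphism_mat:
  assumes "homogeneous d F" "c \<noteq> 0"
  shows "is_automorphism F (mat c)"
  unfolding diag3_eq_mat[symmetric] is_automorphism_diag3_iff[OF assms(2) assms(2) assms(2)]
  using assms by (intro exI[of _ "c ^ d"]) (auto simp: homogeneous_def sum_3 simp flip: power_add)

lemma is_automorphism_mat_mult:
  "homogeneous d F \<Longrightarrow> c \<noteq> 0 \<Longrightarrow> is_automorphism F A \<Longrightarrow> is_automorphism F (mat c ** A)"
  using is_automorphism_mat is_automorphism_mult by blast

lemma is_automorphism_lin_subst_scaled:
  assumes "homogeneous d F" "is_automorphism F A" "invertible P" "k \<noteq> 0" "A ** P = P ** (mat k ** B)"
  shows "is_automorphism (lin_subst P F) B"
proof (rule is_automorphism_lin_subst)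
  show "is_automorphism F (mat (inverse k) ** A)"
    using assms by (intro is_automorphism_mat_mult) auto
  have "mat (inverse k) ** A ** P = mat (inverse k) ** (P ** mat k ** B)"
    by (simp add: assms(5) flip: matrix_mul_assoc)
  also have "\<dots> = mat (inverse k) ** mat k ** (P ** B)"
    by (simp add: matrix_mul_assoc flip: mat_commute[of k P])
  finally show "mat (inverse k) ** A ** P = P ** B"
    using assms(4) by (simp add: mat_mult_mat)
qed (rule assms)

section \<open>Automorphisms of order at most two\<close>

lemma proj_class_square_eq_one_iff:
  assumes "invertible A"
  shows "proj_class A [^]\<^bsub>PGL3\<^esub> (2::nat) = \<one>\<^bsub>PGL3\<^esub> \<longleftrightarrow> (\<exists>c. A ** A = mat c)"
proof -
  interpret group "PGL3 :: ('a ^ 3 ^ 3) set monoid" by (rule group_PGL3)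
  have "proj_class A [^]\<^bsub>PGL3\<^esub> (2::nat) = proj_class (A ** A)"
    using assms by (simp add: numeral_2_eq_2 proj_class_mult proj_class_in_PGL3)
  moreover have "c \<noteq> 0" if "A ** A = mat c" for c
    using that assms invertible_mult[OF assms assms] by (simp add: invertible_mat_iff)
  ultimately show ?thesis
    by (auto simp: one_PGL3 proj_class_eq_iff)
qed

lemma max_automorphism_order_2D:
  assumes "max_automorphism_order F 2"
  shows "automorphisms_square_to_scalars F"
    and "\<exists>A. is_automorphism F A \<and> (\<forall>k. A \<noteq> mat k)"
proof -
  interpret group "PGL3 :: ('a ^ 3 ^ 3) set monoid" by (rule group_PGL3)
  show "automorphisms_square_to_scalars F"
    unfolding automorphisms_square_to_scalars_def
  proof (intro allI impI)
    fix A assume A: "is_automorphism F A"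
    then have "proj_class A \<in> Aut_curve F" and inv: "invertible A"
      by (auto simp: Aut_curve_eq is_automorphism_def)
    then have "0 < ord (proj_class A)" "ord (proj_class A) \<le> 2"
      using assms by (auto simp: max_automorphism_order_def)
    \<comment> \<open>The positive lower bound excludes infinite order, which \<open>ord\<close>
      encodes as 0.\<close>
    then have "ord (proj_class A) = 1 \<or> ord (proj_class A) = 2"
      by linarith
    then have "ord (proj_class A) dvd 2"
      by auto
    then have "proj_class A [^]\<^bsub>PGL3\<^esub> (2::nat) = \<one>\<^bsub>PGL3\<^esub>"
      using inv by (simp add: pow_eq_id proj_class_in_PGL3)
    then show "\<exists>c. A ** A = mat c"
      using inv by (simp add: proj_class_square_eq_one_iff)
  qed
  obtain A where A: "is_automorphism F A" "ord (proj_class A) = 2"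
    using assms by (auto simp: max_automorphism_order_def Aut_curve_eq)
  have "A \<noteq> mat k" for k
  proof
    assume "A = mat k"
    moreover from this have "k \<noteq> 0"
      using A by (simp add: is_automorphism_def invertible_mat_iff)
    ultimately have "proj_class A = \<one>\<^bsub>PGL3\<^esub>"
      by (auto simp: one_PGL3 proj_class_eq_iff mat_mult_mat)
    then show False using A by simp
  qed
  with A show "\<exists>A. is_automorphism F A \<and> (\<forall>k. A \<noteq> mat k)" by blast
qed

section \<open>Sextics invariant under a homology\<close>

text \<open>If every monomial had exponent at most \<open>d - 2\<close> in the \<open>i\<close>-th
  variable, \<open>F\<close> and its first derivatives would vanish at the \<open>i\<close>-th
  coordinate point.\<close>

lemma smooth_imp_key:
  assumes "smooth_plane_curve d F"
  shows "\<exists>m\<in>Poly_Mapping.keys F. d \<le> Suc (expo m i)"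
proof (rule ccontr)
  assume "\<not> ?thesis"
  then have small: "Suc (Suc (expo m i)) \<le> d" if "m \<in> Poly_Mapping.keys F" for m
    using that by fastforce
  have hom: "(\<Sum>j\<in>UNIV. expo m j) = d" if "m \<in> Poly_Mapping.keys F" for m
    using that assms by (auto simp: smooth_plane_curve_def homogeneous_def)
  let ?v = "axis i 1 :: 'a ^ 3"
  \<comment> \<open>At the coordinate point every monomial vanishes except the pure powers of the
    \<open>i\<close>-th variable.\<close>
  have zero: "(\<Prod>j\<in>UNIV. ?v $ j ^ expo n j) = 0" if n: "expo n i < (\<Sum>j\<in>UNIV. expo n j)" for n
  proof -
    have "(\<Sum>j\<in>UNIV. expo n j) = expo n i + (\<Sum>j\<in>UNIV - {i}. expo n j)"
      by (rule sum.remove) auto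
    then have "(\<Sum>j\<in>UNIV - {i}. expo n j) \<noteq> 0"
      using n by linarith
    then obtain j where "j \<in> UNIV - {i}" "expo n j \<noteq> 0"
      by (rule sum.not_neutral_contains_not_neutral)
    then show ?thesis
      by (auto simp: axis_def)
  qed
  have "eval3 F ?v = 0"
    unfolding eval3_def
  proof (rule sum.neutral, rule ballI)
    fix m assume "m \<in> Poly_Mapping.keys F"
    then show "Poly_Mapping.lookup F m * (\<Prod>j\<in>UNIV. ?v $ j ^ expo m j) = 0"
      using small hom by (subst zero) force+
  qed
  moreover have "eval3 (partial_deriv k F) ?v = 0" for k
    unfolding partial_deriv_def eval3_sum
  proof (rule sum.neutral, rule ballI)
    fix m assume m: "m \<in> Poly_Mapping.keys F"
    let ?n = "m - Poly_Mapping.single k 1"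
    show "eval3 (Poly_Mapping.single ?n (of_nat (expo m k) * Poly_Mapping.lookup F m)) ?v = 0"
    proof (cases "expo m k = 0")
      case False
      \<comment> \<open>The differentiated monomial has degree \<open>d - 1\<close> but exponent at
        most \<open>d - 2\<close> in the \<open>i\<close>-th variable, so it is no pure
        power.\<close>
      then have "?n + Poly_Mapping.single k 1 = m"
        by (intro poly_mapping_eqI) (auto simp: lookup_add lookup_minus lookup_single when_def)
      then have "(\<Sum>j\<in>UNIV. expo m j) = (\<Sum>j\<in>UNIV. expo ?n j + expo (Poly_Mapping.single k 1) j)"
        by (metis lookup_add)
      also have "\<dots> = (\<Sum>j\<in>UNIV. expo ?n j) + 1"
        by (simp add: sum.distrib lookup_single when_def)
      finally have "(\<Sum>j\<in>UNIV. expo m j) = (\<Sum>j\<in>UNIV. expo ?n j) + 1" .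
      moreover have "expo ?n i \<le> expo m i"
        by (simp add: lookup_minus)
      ultimately show ?thesis
        using small[OF m] hom[OF m] by (simp add: eval3_single zero)
    qed (simp add: eval3_def)
  qed
  moreover have "?v \<noteq> 0"
    by (simp add: axis_eq_0_iff)
  ultimately show False
    using assms by (auto simp: smooth_plane_curve_def)
qed

text \<open>If \<open>Z\<close> divides the sextic \<open>F = Z Q\<close>, the line \<open>Z = 0\<close> meets \<open>Q = 0\<close> in a singular point.\<close>

lemma smooth_sextic_not_odd:
  fixes F :: "'a::alg_closed_field poly3"
  assumes "smooth_plane_curve 6 F"
  shows "\<exists>m\<in>Poly_Mapping.keys F. even (expo m 3)"
proof (rule ccontr)
  assume "\<not> ?thesis"
  then have odd: "odd (expo m 3)" if "m \<in> Poly_Mapping.keys F" for m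
    using that by blast
  have hom: "expo m 1 + expo m 2 + expo m 3 = 6" if "m \<in> Poly_Mapping.keys F" for m
    using that assms by (auto simp: smooth_plane_curve_def homogeneous_def sum_3)
  let ?S = "{m \<in> Poly_Mapping.keys F. expo m 3 = 1}"
  \<comment> \<open>For \<open>F = Z Q\<close> this is \<open>Q(x,1,0)\<close>, the restriction of
    \<open>Q\<close> to the line \<open>Z = 0\<close> in an affine coordinate.\<close>
  define q where "q = (\<Sum>m\<in>?S. monom (Poly_Mapping.lookup F m) (expo m 1))"
  \<comment> \<open>Smoothness at (1:0:0) and oddness in \<open>Z\<close> force the monomial
    \<open>X^5 Z\<close>, so \<open>q\<close> is nonconstant and has a root.\<close>
  obtain m0 where m0: "m0 \<in> Poly_Mapping.keys F" "6 \<le> Suc (expo m0 1)"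
    using smooth_imp_key[OF assms] by blast
  have m0': "expo m0 1 = 5" "expo m0 2 = 0" "expo m0 3 = 1"
    using hom[OF m0(1)] odd[OF m0(1)] m0(2) by presburger+
  have uniq: "m = m0" if "m \<in> ?S" "expo m 1 = 5" for m
  proof (rule poly_mapping_eqI)
    have "expo m 2 = 0" "expo m 3 = 1"
      using that hom[of m] by auto
    then show "expo m i = expo m0 i" for i
      using exhaust_3[of i] m0' that by auto
  qed
  have "coeff q 5 = (\<Sum>m\<in>?S. if m = m0 then Poly_Mapping.lookup F m else 0)"
    unfolding q_def coeff_sum
  proof (rule sum.cong)
    fix m assume "m \<in> ?S"
    then show "coeff (monom (Poly_Mapping.lookup F m) (expo m 1)) 5 =
        (if m = m0 then Poly_Mapping.lookup F m else 0)"
      using uniq[of m] m0'(1) by (cases "expo m 1 = 5") auto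
  qed simp
  also have "\<dots> = Poly_Mapping.lookup F m0"
    by (subst sum.delta) (simp_all add: m0(1) m0'(3))
  finally have "coeff q 5 \<noteq> 0"
    using m0(1) by (simp add: in_keys_iff)
  then have "degree q > 0"
    using le_degree[of q 5] by simp
  then obtain x where x: "poly q x = 0"
    using alg_closed_imp_poly_has_root by blast
  have pos: "expo m 3 \<noteq> 0" if "m \<in> Poly_Mapping.keys F" for m
    using odd[OF that] by (metis even_zero)
  let ?v = "vector [x, 1, 0] :: 'a ^ 3"
  have "eval3 F ?v = 0"
    unfolding eval3_def by (intro sum.neutral ballI) (auto simp: prod_3 power_0_left dest: pos)
  moreover have "eval3 (partial_deriv k F) ?v = 0" for k
  proof (cases "k = 3")
    case True
    \<comment> \<open>At \<open>Z = 0\<close> only the terms linear in \<open>Z\<close> contribute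
      to the \<open>Z\<close>-derivative, which is therefore \<open>q\<close> at its root.\<close>
    have "eval3 (partial_deriv 3 F) ?v =
        (\<Sum>m\<in>Poly_Mapping.keys F. if expo m 3 = 1 then Poly_Mapping.lookup F m * x ^ expo m 1 else 0)"
      unfolding partial_deriv_def eval3_sum
    proof (rule sum.cong)
      fix m assume "m \<in> Poly_Mapping.keys F"
      then have "expo m 3 \<noteq> 0" by (rule pos)
      then show "eval3 (Poly_Mapping.single (m - Poly_Mapping.single 3 1)
          (of_nat (expo m 3) * Poly_Mapping.lookup F m)) ?v =
        (if expo m 3 = 1 then Poly_Mapping.lookup F m * x ^ expo m 1 else 0)"
        by (auto simp: eval3_single prod_3 lookup_minus lookup_single power_0_left)
    qed simp
    also have "\<dots> = poly q x"
      by (simp add: q_def poly_sum poly_monom sum.If_cases Int_def)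
    finally show ?thesis using x True by simp
  next
    case False
    then show ?thesis
      unfolding partial_deriv_def eval3_sum
      by (intro sum.neutral ballI)
        (auto simp: eval3_single prod_3 lookup_minus lookup_single power_0_left dest: pos)
  qed
  moreover have "?v \<noteq> 0"
    by (simp add: vec_eq_iff forall_3)
  ultimately show False
    using assms by (auto simp: smooth_plane_curve_def)
qed

section \<open>Expansion in powers of Z\<close>

definition Z_coeff :: "nat \<Rightarrow> 'a::comm_ring_1 poly3 \<Rightarrow> 'a poly3" where
  "Z_coeff k F = (\<Sum>m | m \<in> Poly_Mapping.keys F \<and> expo m 3 = k.
     Poly_Mapping.single (m - Poly_Mapping.single 3 k) (Poly_Mapping.lookup F m))"

lemma minus_single_3_add: "expo m 3 = k \<Longrightarrow> m - Poly_Mapping.single 3 k + Poly_Mapping.single 3 k = m"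
  by (intro poly_mapping_eqI) (simp add: lookup_add lookup_minus lookup_single when_def)

lemma eq_sum_Z_coeff:
  assumes "\<And>m. m \<in> Poly_Mapping.keys F \<Longrightarrow> expo m 3 \<le> d"
  shows "F = (\<Sum>k\<le>d. Var 3 ^ k * Z_coeff k F)"
proof -
  have "Var 3 ^ k * Z_coeff k F =
      (\<Sum>m | m \<in> Poly_Mapping.keys F \<and> expo m 3 = k. Poly_Mapping.single m (Poly_Mapping.lookup F m))" for k
    unfolding Z_coeff_def sum_distrib_left
    by (intro sum.cong) (auto simp: Var_power mult_single minus_single_3_add add.commute[of "Poly_Mapping.single 3 _"])
  then have "(\<Sum>k\<le>d. Var 3 ^ k * Z_coeff k F) =
      (\<Sum>m\<in>Poly_Mapping.keys F. Poly_Mapping.single m (Poly_Mapping.lookup F m))"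
    using assms by (simp only:) (rule sum.group, auto)
  then show ?thesis
    using poly_mapping_eq_sum_single[of F] by simp
qed

text \<open>Dividing by \<open>Z^k\<close> is injective on the monomials of
  \<open>Z\<close>-exponent \<open>k\<close>, so no terms merge.\<close>

lemma lookup_Z_coeff:
  assumes "m \<in> Poly_Mapping.keys F" "expo m 3 = k"
  shows "Poly_Mapping.lookup (Z_coeff k F) (m - Poly_Mapping.single 3 k) = Poly_Mapping.lookup F m"
proof -
  have "m' = m" if "expo m' 3 = k" "m' - Poly_Mapping.single 3 k = m - Poly_Mapping.single 3 k" for m'
    using that assms(2) minus_single_3_add by metis
  then have "Poly_Mapping.lookup (Z_coeff k F) (m - Poly_Mapping.single 3 k) =
      (\<Sum>m' | m' \<in> Poly_Mapping.keys F \<and> expo m' 3 = k. if m' = m then Poly_Mapping.lookup F m else 0)"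
    unfolding Z_coeff_def lookup_sum by (intro sum.cong) (auto simp: lookup_single when_def)
  then show ?thesis
    using assms by simp
qed

lemma key_Z_coeff:
  "m \<in> Poly_Mapping.keys F \<Longrightarrow> m - Poly_Mapping.single 3 (expo m 3) \<in> Poly_Mapping.keys (Z_coeff (expo m 3) F)"
  using lookup_Z_coeff[of m F "expo m 3"] by (simp add: in_keys_iff)

lemma keys_Z_coeff:
  assumes "n \<in> Poly_Mapping.keys (Z_coeff k F)"
  obtains m where "m \<in> Poly_Mapping.keys F" "expo m 3 = k" "n = m - Poly_Mapping.single 3 k"
proof -
  have "n \<in> (\<Union>m\<in>{m \<in> Poly_Mapping.keys F. expo m 3 = k}.
      Poly_Mapping.keys (Poly_Mapping.single (m - Poly_Mapping.single 3 k) (Poly_Mapping.lookup F m)))"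
    using subsetD[OF keys_sum assms[unfolded Z_coeff_def]] .
  then show thesis
    using that by (auto split: if_splits)
qed

lemma expo_minus_single_3:
  "expo (m - Poly_Mapping.single 3 k) 1 = expo m 1" "expo (m - Poly_Mapping.single 3 k) 2 = expo m 2"
  "expo (m - Poly_Mapping.single 3 k) 3 = expo m 3 - k"
  by (simp_all add: lookup_minus lookup_single)

lemma binary_form_Z_coeff:
  assumes "homogeneous (d + k) F"
  shows "binary_form d (Z_coeff k F)"
proof -
  have "expo n 3 = 0 \<and> expo n 1 + expo n 2 = d" if "n \<in> Poly_Mapping.keys (Z_coeff k F)" for n
    using that
  proof (rule keys_Z_coeff)
    fix m assume "m \<in> Poly_Mapping.keys F" "expo m 3 = k" "n = m - Poly_Mapping.single 3 k"
    with assms show ?thesis by (auto simp: homogeneous_def sum_3 expo_minus_single_3)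
  qed
  then show ?thesis
    by (auto simp: binary_form_def polys_XY_def homogeneous_def sum_3)
qed

lemma binary_form_0_eq_Const:
  assumes "binary_form 0 P"
  shows "P = Const (Poly_Mapping.lookup P 0)"
proof (rule poly_mapping_eqI)
  fix m
  show "Poly_Mapping.lookup P m = Poly_Mapping.lookup (Const (Poly_Mapping.lookup P 0)) m"
  proof (cases "m \<in> Poly_Mapping.keys P")
    case True
    then have "m = 0"
      using assms by (intro poly_mapping_eqI) (simp add: binary_form_def homogeneous_def)
    then show ?thesis by (simp add: Const_def)
  next
    case False
    then show ?thesis by (auto simp: Const_def lookup_single when_def in_keys_iff)
  qed
qed

lemma binary_form_Const_mult:
  "binary_form d P \<Longrightarrow> c \<noteq> 0 \<Longrightarrow> binary_form d (Const c * P)" for P :: "'a::field poly3"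
  by (simp add: binary_form_def polys_XY_def homogeneous_def keys_Const_mult)

lemma subst3_squares_single:
  "subst3 (\<lambda>i. Var i ^ 2) (Poly_Mapping.single m c) = Poly_Mapping.single (m + m) c"
  by (simp add: subst3_single single_eq_Const_mult_Var[of "m + m"] prod_3 lookup_add
      power2_eq_square power_mult_distrib power_add)

text \<open>In a form of even degree in \<open>X\<close> and \<open>Y\<close> the two exponents have
  equal parity, so testing that of \<open>Y\<close> is enough.\<close>

lemma binary_form_in_polys_X2Y2_iff:
  assumes L: "binary_form d L" "even d"
  shows "L \<in> polys_X2Y2 \<longleftrightarrow> (\<forall>m\<in>Poly_Mapping.keys L. even (expo m 2))"
proof
  assume "L \<in> polys_X2Y2"
  then obtain Q where Q: "L = subst3 (\<lambda>i. Var i ^ 2) Q"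
    by (auto simp: polys_X2Y2_def)
  have "\<forall>m\<in>Poly_Mapping.keys (subst3 (\<lambda>i. Var i ^ 2) Q). even (expo m 2)"
  proof (induction Q rule: poly_mapping_single_add_induct)
    case (single m c)
    show ?case by (auto simp: subst3_squares_single lookup_add)
  next
    case (add p q)
    then show ?case
      unfolding subst3_add
      using keys_add[of "subst3 (\<lambda>i. Var i ^ 2) p" "subst3 (\<lambda>i. Var i ^ 2) q"] by blast
  qed simp
  then show "\<forall>m\<in>Poly_Mapping.keys L. even (expo m 2)"
    by (simp add: Q)
next
  assume even: "\<forall>m\<in>Poly_Mapping.keys L. even (expo m 2)"
  \<comment> \<open>Halving the exponents of \<open>X\<close> and \<open>Y\<close> produces the
    preimage \<open>Q\<close> under the substitution of squares.\<close>
  define half :: "(3 \<Rightarrow>\<^sub>0 nat) \<Rightarrow> (3 \<Rightarrow>\<^sub>0 nat)" where "half m =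
    Poly_Mapping.single 1 (expo m 1 div 2) + Poly_Mapping.single 2 (expo m 2 div 2)" for m
  have expo_half: "expo (half m) 1 = expo m 1 div 2" "expo (half m) 2 = expo m 2 div 2"
    "expo (half m) 3 = 0" for m
    by (simp_all add: half_def lookup_add lookup_single)
  define Q where "Q = (\<Sum>m\<in>Poly_Mapping.keys L. Poly_Mapping.single (half m) (Poly_Mapping.lookup L m))"
  have half: "half m + half m = m" if m: "m \<in> Poly_Mapping.keys L" for m
  proof (rule poly_mapping_eqI)
    have "expo m 1 + expo m 2 + expo m 3 = d" "expo m 3 = 0" "even (expo m 2)"
      using L m even by (auto simp: binary_form_def homogeneous_def polys_XY_def sum_3)
    moreover from this have "even (expo m 1)"
      using L(2) by presburger
    ultimately show "expo (half m + half m) i = expo m i" for i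
      using exhaust_3[of i] by (auto simp: lookup_add expo_half)
  qed
  have "subst3 (\<lambda>i. Var i ^ 2) Q =
      (\<Sum>m\<in>Poly_Mapping.keys L. Poly_Mapping.single m (Poly_Mapping.lookup L m))"
    unfolding Q_def subst3_sum by (intro sum.cong) (simp_all add: subst3_squares_single half)
  then have "L = subst3 (\<lambda>i. Var i ^ 2) Q"
    using poly_mapping_eq_sum_single[of L] by simp
  moreover have "Q \<in> polys_XY"
  proof -
    have "Poly_Mapping.keys Q \<subseteq> half ` Poly_Mapping.keys L"
      unfolding Q_def by (rule order.trans[OF keys_sum]) (auto split: if_splits)
    then show ?thesis
      by (auto simp: polys_XY_def expo_half)
  qed
  ultimately show "L \<in> polys_X2Y2"
    by (auto simp: polys_X2Y2_def)
qed

lemma expo_le_degree_in: "m \<in> Poly_Mapping.keys P \<Longrightarrow> expo m i \<le> degree_in i P"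
  unfolding degree_in_def by (intro Max_ge) auto

lemma minus_one_power_eq_one_iff:
  assumes "(2::'a::field) \<noteq> 0"
  shows "(- 1 :: 'a) ^ n = 1 \<longleftrightarrow> even n"
proof -
  have "(- 1 :: 'a) \<noteq> 1"
    using assms by (metis add.right_inverse one_add_one)
  then show ?thesis
    by (cases "even n") simp_all
qed

text \<open>Invariance under \<open>diag3 1 1 (- 1)\<close> fixes the parity of the
  \<open>Z\<close>-exponents; smoothness and the bound on automorphism orders give the rest. The
  last equivalence lets the final case distinction speak of automorphisms only.\<close>

lemma sextic_normal_form:
  fixes F :: "'a::alg_closed_field poly3"
  assumes two: "(2::'a) \<noteq> 0" and three: "(3::'a) \<noteq> 0"
    and smooth: "smooth_plane_curve 6 F"
    and aut: "is_automorphism F (diag3 1 1 (- 1))"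
    and sq: "automorphisms_square_to_scalars F"
  obtains c L2 L4 L6 where "c \<noteq> 0" "binary_form 2 L2" "binary_form 4 L4" "binary_form 6 L6"
    "F = Const c * (Var 3 ^ 6 + Var 3 ^ 4 * L2 + Var 3 ^ 2 * L4 + L6)"
    "degree_in 1 L6 \<ge> 5" "degree_in 2 L6 \<ge> 5" "L2 \<noteq> 0 \<or> L4 \<noteq> 0"
    "{L2, L4, L6} \<subseteq> polys_X2Y2 \<longleftrightarrow> is_automorphism F (diag3 1 (- 1) 1)"
proof -
  have hom6: "homogeneous 6 F"
    using smooth by (simp add: smooth_plane_curve_def)
  then have hom: "expo m 1 + expo m 2 + expo m 3 = 6" if "m \<in> Poly_Mapping.keys F" for m
    using that by (auto simp: homogeneous_def sum_3)
  \<comment> \<open>One sign \<open>k\<close> serves all terms; as some \<open>Z\<close>-exponent is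
    even, it is 1.\<close>
  obtain k :: 'a where k: "\<And>m. m \<in> Poly_Mapping.keys F \<Longrightarrow> (- 1) ^ expo m 3 = k"
    using aut by (simp add: is_automorphism_diag3_iff) blast
  obtain m where "m \<in> Poly_Mapping.keys F" "even (expo m 3)"
    using smooth_sextic_not_odd[OF smooth] by blast
  then have "k = 1"
    using k by force
  then have even3: "even (expo m 3)" if "m \<in> Poly_Mapping.keys F" for m
    using k[OF that] minus_one_power_eq_one_iff[OF two] by metis
  \<comment> \<open>Smoothness at (0:0:1) gives a \<open>Z\<close>-exponent of at least 5, and
    parity raises it to 6.\<close>
  obtain z where "z \<in> Poly_Mapping.keys F" "6 \<le> Suc (expo z 3)"
    using smooth_imp_key[OF smooth] by blast
  then have z: "z \<in> Poly_Mapping.keys F" "expo z 3 = 6" "expo z 2 = 0" "expo z 1 = 0"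
    using hom[of z] even3[of z] by presburger+
  have "binary_form 0 (Z_coeff 6 F)"
    by (rule binary_form_Z_coeff) (simp add: hom6)
  then obtain c where c: "Z_coeff 6 F = Const c"
    using binary_form_0_eq_Const by blast
  have "c \<noteq> 0"
    using key_Z_coeff[OF z(1)] z(2) c by auto
  \<comment> \<open>Indexed by the power of \<open>Z\<close>: \<open>L 4\<close>, \<open>L 2\<close>
    and \<open>L 0\<close> become \<open>L2\<close>, \<open>L4\<close> and \<open>L6\<close>. The
    factor normalises the coefficient of \<open>Z^6\<close> to 1.\<close>
  define L where "L k = Const (inverse c) * Z_coeff k F" for k
  have Z_coeff: "Z_coeff k F = Const c * L k" for k
    using \<open>c \<noteq> 0\<close> by (simp add: L_def mult.assoc[symmetric] flip: Const_mult)
  have keys_L: "Poly_Mapping.keys (L k) = Poly_Mapping.keys (Z_coeff k F)" for k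
    using \<open>c \<noteq> 0\<close> by (simp add: L_def keys_Const_mult)
  have binary: "binary_form d (L k)" if "d + k = 6" for d k
    unfolding L_def using \<open>c \<noteq> 0\<close> hom6 that
    by (intro binary_form_Const_mult binary_form_Z_coeff) auto
  have odd: "Z_coeff k F = 0" if "odd k" for k
    using even3 that unfolding Z_coeff_def by (intro sum.neutral) auto
  have "F = (\<Sum>k\<le>6. Var 3 ^ k * Z_coeff k F)"
    using hom by (intro eq_sum_Z_coeff) fastforce
  also have "\<dots> = Var 3 ^ 6 * Const c + Var 3 ^ 4 * Z_coeff 4 F + Var 3 ^ 2 * Z_coeff 2 F + Z_coeff 0 F"
  proof -
    have "{..6::nat} = {0, 1, 2, 3, 4, 5, 6}"
      by auto
    then show ?thesis
      by (simp add: odd c add_ac)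
  qed
  also have "\<dots> = Const c * (Var 3 ^ 6 + Var 3 ^ 4 * L 4 + Var 3 ^ 2 * L 2 + L 0)"
    by (simp add: Z_coeff distrib_left mult.left_commute[of "Const c"] mult.commute[of _ "Const c"])
  finally have F: "F = Const c * (Var 3 ^ 6 + Var 3 ^ 4 * L 4 + Var 3 ^ 2 * L 2 + L 0)" .
  have degree: "degree_in i (L 0) \<ge> 5" if "i = 1 \<or> i = 2" for i
  proof -
    obtain m where m: "m \<in> Poly_Mapping.keys F" "6 \<le> Suc (expo m i)"
      using smooth_imp_key[OF smooth] by blast
    then have "expo m 3 < 2"
      using hom[OF m(1)] that by auto
    then have "expo m 3 = 0"
      using even3[OF m(1)] by presburger
    then have "m \<in> Poly_Mapping.keys (L 0)"
      using key_Z_coeff[OF m(1)] by (simp add: keys_L)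
    then show ?thesis
      using expo_le_degree_in[of m "L 0" i] m(2) by simp
  qed
  have "L 4 \<noteq> 0 \<or> L 2 \<noteq> 0"
  proof (rule ccontr)
    assume *: "\<not> ?thesis"
    have m3: "expo m 3 = 0 \<or> expo m 3 = 6" if m: "m \<in> Poly_Mapping.keys F" for m
    proof -
      have "expo m 3 \<noteq> 2 \<and> expo m 3 \<noteq> 4"
        using key_Z_coeff[OF m] * by (auto simp: keys_L[symmetric])
      then show ?thesis
        using hom[OF m] even3[OF m] by presburger
    qed
    \<comment> \<open>A primitive cube root of unity; \<open>w = 1\<close> would give
      \<open>3 = 0\<close>. Multiplying \<open>Z\<close> by \<open>w\<close> preserves
      \<open>F\<close> but does not square to a scalar.\<close>
    obtain w :: 'a where "poly [:1, 1, 1:] w = 0"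
      using alg_closed_imp_poly_has_root[of "[:1, 1, 1 :: 'a:]"] by auto
    then have w: "w * w + w + 1 = 0"
      by (simp add: algebra_simps)
    then have "w \<noteq> 0" "w \<noteq> 1"
      using three by auto
    have "w ^ 3 - 1 = (w - 1) * (w * w + w + 1)"
      by (simp add: power3_eq_cube algebra_simps)
    then have w3: "w ^ 3 = 1"
      by (simp add: w)
    then have "w ^ 6 = 1"
      using power_mult[of w 3 2] by simp
    then have "is_automorphism F (diag3 1 1 w)"
      using m3 \<open>w \<noteq> 0\<close> by (subst is_automorphism_diag3_iff) (auto intro!: exI[of _ 1], fastforce)
    then obtain d where "diag3 1 1 w ** diag3 1 1 w = mat d"
      using sq by (auto simp: automorphisms_square_to_scalars_def)
    then have "w * w = 1"
      by (simp add: diag3_mult diag3_eq_iff flip: diag3_eq_mat)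
    then have "w = 1"
      using w3 by (simp add: power3_eq_cube)
    with \<open>w \<noteq> 1\<close> show False ..
  qed
  moreover have "{L 4, L 2, L 0} \<subseteq> polys_X2Y2 \<longleftrightarrow> is_automorphism F (diag3 1 (- 1) 1)"
  proof -
    have "{L 4, L 2, L 0} \<subseteq> polys_X2Y2 \<longleftrightarrow>
        (\<forall>k\<in>{4, 2, 0}. \<forall>n\<in>Poly_Mapping.keys (Z_coeff k F). even (expo n 2))"
      using binary_form_in_polys_X2Y2_iff[OF binary] by (simp add: keys_L)
    also have "\<dots> \<longleftrightarrow> (\<forall>m\<in>Poly_Mapping.keys F. even (expo m 2))"
    proof (intro iffI ballI)
      fix m assume *: "\<forall>k\<in>{4, 2, 0}. \<forall>n\<in>Poly_Mapping.keys (Z_coeff k F). even (expo n 2)"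
        and m: "m \<in> Poly_Mapping.keys F"
      \<comment> \<open>The only case outside the three forms is the monomial \<open>Z^6\<close>,
        which does not contain \<open>Y\<close>.\<close>
      have "expo m 3 \<in> {4, 2, 0} \<or> expo m 2 = 0"
        using hom[OF m] even3[OF m] by simp presburger
      then show "even (expo m 2)"
        using * key_Z_coeff[OF m] by (metis expo_minus_single_3(2) even_zero)
    next
      fix k n assume *: "\<forall>m\<in>Poly_Mapping.keys F. even (expo m 2)"
        and "n \<in> Poly_Mapping.keys (Z_coeff k F)"
      then show "even (expo n 2)"
        by (metis keys_Z_coeff expo_minus_single_3(2))
    qed
    also have "\<dots> \<longleftrightarrow> (\<forall>m\<in>Poly_Mapping.keys F. (- 1 :: 'a) ^ expo m 2 = 1)"
      by (simp add: minus_one_power_eq_one_iff[OF two])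
    also have "\<dots> \<longleftrightarrow> (\<exists>k::'a. k \<noteq> 0 \<and> (\<forall>m\<in>Poly_Mapping.keys F. (- 1) ^ expo m 2 = k))"
    \<comment> \<open>The common value \<open>k\<close> is 1, as the term \<open>Z^6\<close>
      shows.\<close>
    proof safe
      fix k :: 'a and m
      assume *: "\<forall>m\<in>Poly_Mapping.keys F. (- 1) ^ expo m 2 = k" and m: "m \<in> Poly_Mapping.keys F"
      then show "(- 1) ^ expo m 2 = (1::'a)"
        using z by (metis power_0)
    qed (auto intro!: exI[of _ 1])
    also have "\<dots> \<longleftrightarrow> is_automorphism F (diag3 1 (- 1) 1)"
      by (simp add: is_automorphism_diag3_iff)
    finally show ?thesis .
  qed
  ultimately show thesis
    using that[OF \<open>c \<noteq> 0\<close> binary binary binary F] degree by simp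
qed

section \<open>Classification of the sextics and their automorphism groups\<close>

theorem theorem2p1:
  fixes F :: "'a::alg_closed_field poly3"
  assumes char: "CHAR('a) = 0 \<or> CHAR('a) > 2 * plane_genus 6 + 1"
    and smooth: "smooth_plane_curve 6 F"
    and max_order: "max_automorphism_order F 2"
  shows "\<exists>L2 L4 L6 G :: 'a poly3.
           binary_form 2 L2 \<and> binary_form 4 L4 \<and> binary_form 6 L6 \<and>
           G = Var 3 ^ 6 + Var 3 ^ 4 * L2 + Var 3 ^ 2 * L4 + L6 \<and>
           proj_equiv F G \<and>
           degree_in 1 L6 \<ge> 5 \<and> degree_in 2 L6 \<ge> 5 \<and>
           (L2 \<noteq> 0 \<or> L4 \<noteq> 0) \<and>
           (\<not> {L2, L4, L6} \<subseteq> polys_X2Y2 \<longrightarrow> Aut_curve G = rho1_Z2) \<and>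
           ({L2, L4, L6} \<subseteq> polys_X2Y2 \<longrightarrow> Aut_curve G = rho1_Z2_Z2)"
proof -
  let ?s = "diag3 1 1 (- 1) :: 'a ^ 3 ^ 3" and ?t = "diag3 1 (- 1) 1 :: 'a ^ 3 ^ 3"
  \<comment> \<open>The genus is 10, so a nonzero characteristic exceeds 21.\<close>
  have "\<not> CHAR('a) dvd 2" "\<not> CHAR('a) dvd 3"
    using char dvd_imp_le[of "CHAR('a)" 2] dvd_imp_le[of "CHAR('a)" 3]
    by (auto simp: plane_genus_def)
  then have two: "(2::'a) \<noteq> 0" and three: "(3::'a) \<noteq> 0"
    using of_nat_eq_0_iff_char_dvd[of 2] of_nat_eq_0_iff_char_dvd[of 3] by auto
  have neg: "x \<noteq> - x" if "x \<noteq> 0" for x :: 'a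
    using that two by (metis add.right_inverse mult_2 mult_eq_0_iff)
  \<comment> \<open>Reduces the theorem to finding coordinates \<open>P\<close> in which
    \<open>?s\<close> is an automorphism and \<open>?t\<close> decides between the two
    groups.\<close>
  have normal_form: ?thesis
    if P: "invertible P" and s: "is_automorphism (lin_subst P F) ?s"
      and not_t: "\<not> is_automorphism (lin_subst P F) ?t \<Longrightarrow> Aut_curve (lin_subst P F) = rho1_Z2"
      and t: "is_automorphism (lin_subst P F) ?t \<Longrightarrow> Aut_curve (lin_subst P F) = rho1_Z2_Z2"
    for P
  proof -
    let ?F = "lin_subst P F"
    have smooth': "smooth_plane_curve 6 ?F"
      using smooth P by (rule smooth_lin_subst)
    have sq': "automorphisms_square_to_scalars ?F"
      using max_automorphism_order_2D(1)[OF max_order] P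
      by (rule automorphisms_square_to_scalars_lin_subst)
    obtain c L2 L4 L6 where c: "c \<noteq> 0"
      and L: "binary_form 2 L2" "binary_form 4 L4" "binary_form 6 L6"
        "?F = Const c * (Var 3 ^ 6 + Var 3 ^ 4 * L2 + Var 3 ^ 2 * L4 + L6)"
        "degree_in 1 L6 \<ge> 5" "degree_in 2 L6 \<ge> 5" "L2 \<noteq> 0 \<or> L4 \<noteq> 0"
      and X2Y2: "{L2, L4, L6} \<subseteq> polys_X2Y2 \<longleftrightarrow> is_automorphism ?F ?t"
      by (rule sextic_normal_form[OF two three smooth' s sq'])
    define G where "G = Var 3 ^ 6 + Var 3 ^ 4 * L2 + Var 3 ^ 2 * L4 + L6"
    have FG: "?F = Const c * G"
      unfolding G_def by (rule L(4))
    have "proj_equiv F G"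
      unfolding proj_equiv_def using P c FG by blast
    moreover have "Aut_curve G = Aut_curve ?F"
      unfolding FG using c by (rule Aut_curve_Const_mult[symmetric])
    ultimately show ?thesis
      using L X2Y2 not_t t G_def by metis
  qed
  have hom: "homogeneous 6 F"
    using smooth by (simp add: smooth_plane_curve_def)
  have sq: "automorphisms_square_to_scalars F"
    using max_order by (rule max_automorphism_order_2D)
  obtain A where A: "is_automorphism F A" "\<And>k. A \<noteq> mat k"
    using max_automorphism_order_2D(2)[OF max_order] by blast
  obtain b where b: "A ** A = mat b"
    using sq A(1) by (auto simp: automorphisms_square_to_scalars_def)
  have "invertible (mat b :: 'a ^ 3 ^ 3)"
    using A(1) by (auto simp: is_automorphism_def invertible_mult simp flip: b)
  then have "b \<noteq> 0"
    by (simp add: invertible_mat_iff)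
  \<comment> \<open>Algebraic closedness provides the eigenvalue needed for the normal form.\<close>
  obtain a where "a * a = b"
    using nth_root_exists[of 2 b] by (auto simp: power2_eq_square)
  then have "A ** A = mat (a * a)" "a \<noteq> 0"
    using b \<open>b \<noteq> 0\<close> by auto
  then obtain P k where P: "invertible P" "k \<noteq> 0" "A ** P = P ** (mat k ** ?s)"
    using involution_normal_form[of A a] two A(2) by blast
  define F0 where "F0 = lin_subst P F"
  have hom0: "homogeneous 6 F0"
    unfolding F0_def using hom by (rule homogeneous_lin_subst)
  have sq0: "automorphisms_square_to_scalars F0"
    unfolding F0_def using sq P(1) by (rule automorphisms_square_to_scalars_lin_subst)
  have s0: "is_automorphism F0 ?s"
    unfolding F0_def using hom A(1) P by (rule is_automorphism_lin_subst_scaled)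
  have nonzero: "x \<noteq> 0" if "is_automorphism H (mat x ** B)" for H x and B :: "'a ^ 3 ^ 3"
    using that by (auto simp: is_automorphism_def invertible_det_nz mat_mult_left det_3)
  show ?thesis
  \<comment> \<open>Either the classes of the identity and \<open>?s\<close> are all automorphisms,
    or some further \<open>B\<close> must be diagonalised as well.\<close>
  proof (cases "\<forall>B. is_automorphism F0 B \<longrightarrow> (\<exists>x. B = mat x ** mat 1 \<or> B = mat x ** ?s)")
    case True
    have "proj_class B \<in> proj_class ` {mat 1, ?s}" if B: "is_automorphism F0 B" for B
    proof -
      obtain x M where "B = mat x ** M" "M \<in> {mat 1, ?s}"
        using True B by blast
      then show ?thesis
        using nonzero B by (metis imageI proj_class_eq_iff)
    qed
    moreover have "is_automorphism F0 (mat 1)"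
      using hom0 by (rule is_automorphism_mat) simp
    ultimately have "Aut_curve F0 = rho1_Z2"
      unfolding Aut_curve_eq rho1_Z2_eq using s0 by auto
    moreover have "\<not> is_automorphism F0 ?t"
    proof
      assume "is_automorphism F0 ?t"
      then obtain x where "?t = diag3 x x x \<or> ?t = diag3 x x (- x)"
        using True by (auto simp: diag3_eq_mat mat_mult_diag3)
      then show False
        using neg[of 1] by (auto simp: diag3_eq_iff)
    qed
    ultimately show ?thesis
      using P(1) s0 unfolding F0_def by (intro normal_form) auto
  next
    case False
    then obtain B where B: "is_automorphism F0 B" "\<And>x. B \<noteq> mat x" "\<And>x. B \<noteq> mat x ** ?s"
      by auto
    \<comment> \<open>Both traces equal 1, so every automorphism matrix commutes with
      \<open>?s\<close> here, and later with \<open>?t\<close>.\<close>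
    have "trace ?s \<noteq> 0" "trace ?t \<noteq> 0"
      by (simp_all add: trace_diag3)
    then have "B ** ?s = ?s ** B"
      using automorphisms_commute[OF sq0 B(1) s0] by simp
    moreover obtain b where "B ** B = mat b"
      using sq0 B(1) by (auto simp: automorphisms_square_to_scalars_def)
    moreover have "invertible B"
      using B(1) by (simp add: is_automorphism_def)
    ultimately obtain Q k where Q: "invertible Q" "k \<noteq> 0" "B ** Q = Q ** (mat k ** ?t)"
      "?s ** Q = Q ** ?s"
      using block_involution_normal_form[of B b] two B(2,3) by metis
    \<comment> \<open>The second base change \<open>Q\<close> commutes with \<open>?s\<close>, so
      \<open>?s\<close> stays an automorphism while \<open>B\<close> turns into
      \<open>?t\<close>.\<close>
    define F1 where "F1 = lin_subst (P ** Q) F"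
    have F1: "F1 = lin_subst Q F0"
      by (simp add: F1_def F0_def lin_subst_lin_subst)
    have hom1: "homogeneous 6 F1"
      unfolding F1_def using hom by (rule homogeneous_lin_subst)
    have sq1: "automorphisms_square_to_scalars F1"
      unfolding F1 using sq0 Q(1) by (rule automorphisms_square_to_scalars_lin_subst)
    have s1: "is_automorphism F1 ?s"
      unfolding F1 using s0 Q(1,4) by (rule is_automorphism_lin_subst)
    have t1: "is_automorphism F1 ?t"
      unfolding F1 using hom0 B(1) Q(1-3) by (rule is_automorphism_lin_subst_scaled)
    have diag: "proj_class C \<in> proj_class ` {mat 1, ?s, ?t, diag3 1 (- 1) (- 1)}"
      if C: "is_automorphism F1 C" for C
    proof -
      have "C ** ?s = ?s ** C" "C ** ?t = ?t ** C"
        using automorphisms_commute[OF sq1 C] s1 t1 \<open>trace ?s \<noteq> 0\<close> \<open>trace ?t \<noteq> 0\<close> by blast+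
      note st = commute_diag3[OF this(1)] commute_diag3[OF this(2)]
      have eq0: "x = 0" if "x = - x \<or> - x = x" for x :: 'a
        using that neg by metis
      \<comment> \<open>The relation with \<open>?t\<close> kills the entries mixing
        \<open>X\<close> and \<open>Y\<close>, the one with \<open>?s\<close> those mixing
        \<open>Z\<close> with \<open>X\<close> or \<open>Y\<close>.\<close>
      have off: "C $ 1 $ 2 = 0" "C $ 1 $ 3 = 0" "C $ 2 $ 1 = 0" "C $ 2 $ 3 = 0" "C $ 3 $ 1 = 0"
        "C $ 3 $ 2 = 0"
        using st(2)[of 1 2] st(1)[of 1 3] st(2)[of 2 1] st(1)[of 2 3] st(1)[of 3 1] st(1)[of 3 2]
        by (auto intro: eq0)
      define x where "x = C $ 1 $ 1"
      have C_eq: "C = diag3 x (C $ 2 $ 2) (C $ 3 $ 3)"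
        by (simp add: vec_eq_iff forall_3 diag3_def off x_def)
      obtain d where "C ** C = mat d"
        using sq1 C by (auto simp: automorphisms_square_to_scalars_def)
      then have "diag3 (x * x) (C $ 2 $ 2 * C $ 2 $ 2) (C $ 3 $ 3 * C $ 3 $ 3) = diag3 d d d"
        using C_eq by (metis diag3_mult diag3_eq_mat)
      then have "C $ 2 $ 2 * C $ 2 $ 2 = x * x" "C $ 3 $ 3 * C $ 3 $ 3 = x * x"
        by (simp_all add: diag3_eq_iff)
      then have "C $ 2 $ 2 = x \<or> C $ 2 $ 2 = - x" "C $ 3 $ 3 = x \<or> C $ 3 $ 3 = - x"
        by (simp_all add: square_eq_iff)
      \<comment> \<open>Factoring out the first diagonal entry \<open>x\<close> leaves four sign
        patterns, one for each element of the group.\<close>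
      then have "C \<in> (\<lambda>M. mat x ** M) ` {diag3 1 1 1, ?s, ?t, diag3 1 (- 1) (- 1)}"
        by (subst C_eq) (auto simp: mat_mult_diag3)
      then obtain M where "M \<in> {mat 1, ?s, ?t, diag3 1 (- 1) (- 1)}" "C = mat x ** M"
        unfolding diag3_eq_mat by blast
      then show ?thesis
        using nonzero C by (metis imageI proj_class_eq_iff)
    qed
    have "is_automorphism F1 (mat 1)"
      using hom1 by (rule is_automorphism_mat) simp
    moreover have "is_automorphism F1 (diag3 1 (- 1) (- 1))"
      using is_automorphism_mult[OF s1 t1] by (simp add: diag3_mult)
    ultimately have "Aut_curve F1 = rho1_Z2_Z2"
      unfolding Aut_curve_eq rho1_Z2_Z2_eq using s1 t1 diag by auto
    moreover have "invertible (P ** Q)"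
      using P(1) Q(1) by (rule invertible_mult)
    ultimately show ?thesis
      using s1 t1 unfolding F1_def by (intro normal_form) auto
  qed
qed

end
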